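(* Let $0<\xi^-<\xi^0<\xi^+<1$, and let $\gamma^->0$, $\gamma^+>0$ be real numbers with $\gamma^-+\gamma^+\le 1$. Put $R^-=(0,\xi^0)\times(0,1)$, $R^+=(\xi^0,1)\times(0,1)$. If $f^-$, $f^+$ and $\phi_0$ are sufficiently smooth, then the nonlocal contact problem for the Poisson equation has a unique regular solution. Precisely: there is an integer $m\ge 0$ such that for all $f^-\in C^m(\overline{R^-})$, $f^+\in C^m(\overline{R^+})$ and $\phi_0\in C^m([0,1])$ with $\phi_0(0)=\phi_0(1)=0$, there exists exactly one continuous function $u:[0,1]\times[0,1]\to\mathbb{R}$ whose restrictions $u^-=u|_{R^-}$ and $u^+=u|_{R^+}$ are of class $C^2$ and which satisfies (i) $\Delta u^-=f^-$ in $R^-$ and $\Delta u^+=f^+$ in $R^+$; (ii) $u=0$ on the boundary of $[0,1]\times[0,1]$; (iii) $u(\xi^0,x_2)=\gamma^-u(\xi^-,x_2)+\gamma^+u(\xi^+,x_2)+\phi_0(x_2)$ for all $0<x_2<1$.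
   Context: $\Delta=\partial^2/\partial x_1^2+\partial^2/\partial x_2^2$. A regular solution means a function continuous on the closed square, twice continuously differentiable in each of the two open subrectangles $R^-$ and $R^+$, and satisfying the equations, boundary conditions and nonlocal contact condition listed in the claim. No differential equation and no differentiability is required across the line $x_1=\xi^0$. $C^m(\overline{R^\pm})$ denotes functions with all partial derivatives up to order $m$ continuous up to the boundary. *)

theory Defs
  imports "HOL-Analysis.Analysis"
begin

(* Points of the plane are pairs (x1, x2) :: real \<times> real. *)

definition pd1 :: "(real \<times> real \<Rightarrow> real) \<Rightarrow> real \<times> real \<Rightarrow> real" where
  "pd1 f = (\<lambda>(x, y). deriv (\<lambda>t. f (t, y)) x)"

definition pd2 :: "(real \<times> real \<Rightarrow> real) \<Rightarrow> real \<times> real \<Rightarrow> real" where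
  "pd2 f = (\<lambda>(x, y). deriv (\<lambda>t. f (x, t)) y)"

definition has_pds_on :: "(real \<times> real) set \<Rightarrow> (real \<times> real \<Rightarrow> real) \<Rightarrow> bool" where
  "has_pds_on S f \<longleftrightarrow> (\<forall>(x, y) \<in> S.
     (\<lambda>t. f (t, y)) field_differentiable (at x) \<and>
     (\<lambda>t. f (x, t)) field_differentiable (at y))"

definition laplacian :: "(real \<times> real \<Rightarrow> real) \<Rightarrow> real \<times> real \<Rightarrow> real" where
  "laplacian u p = pd1 (pd1 u) p + pd2 (pd2 u) p"

(* Class C^k on an open set S: all iterated partial derivatives up to order k,
   in any order of differentiation, exist and are continuous on S. *)
primrec Ck_open :: "nat \<Rightarrow> (real \<times> real) set \<Rightarrow> (real \<times> real \<Rightarrow> real) \<Rightarrow> bool" where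
  "Ck_open 0 S f \<longleftrightarrow> continuous_on S f"
| "Ck_open (Suc k) S f \<longleftrightarrow> continuous_on S f \<and> has_pds_on S f \<and>
     Ck_open k S (pd1 f) \<and> Ck_open k S (pd2 f)"

definition extends_continuously :: "'a::topological_space set \<Rightarrow> ('a \<Rightarrow> real) \<Rightarrow> bool" where
  "extends_continuously S f \<longleftrightarrow>
     (\<exists>g. continuous_on (closure S) g \<and> (\<forall>x\<in>S. g x = f x))"

primrec pds_extend :: "nat \<Rightarrow> (real \<times> real) set \<Rightarrow> (real \<times> real \<Rightarrow> real) \<Rightarrow> bool" where
  "pds_extend 0 S f \<longleftrightarrow> extends_continuously S f"
| "pds_extend (Suc k) S f \<longleftrightarrow> extends_continuously S f \<and> has_pds_on S f \<and>
     pds_extend k S (pd1 f) \<and> pds_extend k S (pd2 f)"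

(* C^k(closure S) for an open set S. The derivatives are taken in S only and are required
   to be continuous up to the boundary, i.e. to extend continuously to closure S; f itself
   is given on closure S, so it has to be its own extension. *)
definition Ck_closure :: "nat \<Rightarrow> (real \<times> real) set \<Rightarrow> (real \<times> real \<Rightarrow> real) \<Rightarrow> bool" where
  "Ck_closure k S f \<longleftrightarrow> continuous_on (closure S) f \<and> pds_extend k S f"

(* One-dimensional analogue: C^k([a,b]). *)
definition Ck_interval :: "nat \<Rightarrow> real \<Rightarrow> real \<Rightarrow> (real \<Rightarrow> real) \<Rightarrow> bool" where
  "Ck_interval k a b \<phi> \<longleftrightarrow> continuous_on {a..b} \<phi> \<and>
     (\<forall>j<k. \<forall>x\<in>{a<..<b}. (deriv ^^ j) \<phi> field_differentiable (at x)) \<and>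
     (\<forall>j\<le>k. extends_continuously {a<..<b} ((deriv ^^ j) \<phi>))"

definition unit_square :: "(real \<times> real) set" where
  "unit_square = {0..1} \<times> {0..1}"

definition R_minus :: "real \<Rightarrow> (real \<times> real) set" where
  "R_minus \<xi>0 = {0<..<\<xi>0} \<times> {0<..<1}"

definition R_plus :: "real \<Rightarrow> (real \<times> real) set" where
  "R_plus \<xi>0 = {\<xi>0<..<1} \<times> {0<..<1}"

(* The arguments xm, x0, xp, gm, gp are xi^-, xi^0, xi^+, gamma^-, gamma^+, and fm, fp are
   f^-, f^+. *)
definition regular_solution ::
  "real \<Rightarrow> real \<Rightarrow> real \<Rightarrow> real \<Rightarrow> real \<Rightarrow> (real \<times> real \<Rightarrow> real) \<Rightarrow> (real \<times> real \<Rightarrow> real) \<Rightarrow>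
   (real \<Rightarrow> real) \<Rightarrow> (real \<times> real \<Rightarrow> real) \<Rightarrow> bool" where
  "regular_solution xm x0 xp gm gp fm fp \<phi>0 u \<longleftrightarrow>
     continuous_on unit_square u \<and>
     Ck_open 2 (R_minus x0) u \<and> Ck_open 2 (R_plus x0) u \<and>
     (\<forall>p \<in> R_minus x0. laplacian u p = fm p) \<and>
     (\<forall>p \<in> R_plus x0. laplacian u p = fp p) \<and>
     (\<forall>p \<in> frontier unit_square. u p = 0) \<and>
     (\<forall>y \<in> {0<..<1}. u (x0, y) = gm * u (xm, y) + gp * u (xp, y) + \<phi>0 y)"

end

(* Poisson's equation on each subrectangle is first solved with zero boundary values. A particular
   solution comes from the sine expansion in x2 of f minus the linear interpolation of its values
   at x2 = 0 and x2 = 1: the coefficients of this difference are O(n^-2), so solving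
   u'' - (n pi)^2 u = f_n with bounded kernels exp(-n pi |x - s|) gives a series that can be
   differentiated twice termwise. Its boundary values are then removed by solving the Dirichlet
   problem for Laplace's equation, side by side, with
   sum g_n sinh(n pi x) / sinh(n pi a) sin(n pi y).
   What is left is the unknown trace g of the solution on x1 = xi0. On sine coefficients the
   contact condition reads g_n (1 - mu_n) = h_n, where
   mu_n = gm sinh(n pi xm) / sinh(n pi x0) + gp sinh(n pi (1 - xp)) / sinh(n pi (1 - x0))
   stays below a constant < 1 and decays exponentially. Hence g = h + sum g_n mu_n sin(n pi y)
   is continuous, without any smoothness of h.
   Uniqueness: if M is the maximum of |u - v| on x1 = xi0, comparison with the affine functions
   M x1 / xi0 and M (1 - x1) / (1 - xi0) bounds |u - v| strictly below M at xi- and xi+. *)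

theory Submission
  imports Defs
begin

section \<open>Functions of class C2 with a prescribed Laplacian\<close>

text \<open>The boundary values met on the way are only known to be continuous, and the sine series
  of a continuous function need not converge to it. So harmonic functions with data on one side are
  obtained as uniform limits of absolutely convergent series, where the maximum principle carries
  the approximation error from the side to the whole closed rectangle. The smoothness order 2 comes
  from the particular solution: two derivatives of f in x2 give coefficients O(n^-2), the ordinary
  differential equation gains another n^-2, two derivatives of the solution use up this gain, and a
  convergent sum of n^-2 remains. That solution is left free on the boundary, so its values may be
  nonzero at the corners, where all sine terms vanish. A harmonic function that is affine in each
  variable removes the corner values before the four sides are treated separately.\<close>

definition has_partials ::
  "(real \<times> real) set \<Rightarrow> (real \<times> real \<Rightarrow> real) \<Rightarrow> (real \<times> real \<Rightarrow> real) \<Rightarrow> (real \<times> real \<Rightarrow> real) \<Rightarrow> bool"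
  where "has_partials S u ux uy \<longleftrightarrow> continuous_on S u \<and>
    (\<forall>x y. (x, y) \<in> S \<longrightarrow>
      ((\<lambda>t. u (t, y)) has_real_derivative ux (x, y)) (at x) \<and>
      ((\<lambda>t. u (x, t)) has_real_derivative uy (x, y)) (at y))"

text \<open>The derivatives are explicit witnesses rather than iterated \<open>deriv\<close>, so
  that sums, series and changes of variables are handled by exhibiting functions. Both mixed
  derivatives occur because \<open>Ck_open\<close> differentiates in either order. The quantifier
  hides the witnesses, hence the value of the Laplacian is part of the predicate.\<close>

definition C2_laplacian ::
  "(real \<times> real) set \<Rightarrow> (real \<times> real \<Rightarrow> real) \<Rightarrow> (real \<times> real \<Rightarrow> real) \<Rightarrow> bool"
  where "C2_laplacian S u F \<longleftrightarrow> (\<exists>ux uy uxx uxy uyx uyy.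
    has_partials S u ux uy \<and> has_partials S ux uxx uxy \<and> has_partials S uy uyx uyy \<and>
    continuous_on S uxx \<and> continuous_on S uxy \<and> continuous_on S uyx \<and> continuous_on S uyy \<and>
    (\<forall>z\<in>S. uxx z + uyy z = F z))"

lemma has_partials_lin:
  assumes "has_partials S u ux uy" "has_partials S v vx vy"
  shows "has_partials S (\<lambda>z. a * u z + b * v z) (\<lambda>z. a * ux z + b * vx z) (\<lambda>z. a * uy z + b * vy z)"
  using assms unfolding has_partials_def
  by (auto intro!: continuous_intros derivative_eq_intros)

lemma open_slices:
  assumes "open (S :: (real \<times> real) set)"
  shows "open {t. (t, y) \<in> S}" "open {t. (x, t) \<in> S}"
proof -
  have "open ((\<lambda>t. (t, y)) -` S)" "open ((\<lambda>t. (x, t)) -` S)"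
    by (auto intro!: open_vimage assms continuous_intros)
  then show "open {t. (t, y) \<in> S}" "open {t. (x, t) \<in> S}" by (auto simp: vimage_def)
qed

text \<open>Openness of \<open>S\<close> makes \<open>v\<close> and \<open>u\<close> agree near each
  of its points along both coordinate lines, which is what the transfer of a derivative
  requires.\<close>

lemma has_partials_cong:
  assumes S: "open S" and h: "has_partials S u ux uy"
    and eq: "\<And>z. z \<in> S \<Longrightarrow> v z = u z" "\<And>z. z \<in> S \<Longrightarrow> vx z = ux z" "\<And>z. z \<in> S \<Longrightarrow> vy z = uy z"
  shows "has_partials S v vx vy"
  unfolding has_partials_def
proof (intro conjI allI impI)
  show "continuous_on S v" using h eq(1) unfolding has_partials_def by (simp cong: continuous_on_cong)
next
  fix x y assume z: "(x, y) \<in> S"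
  have "((\<lambda>t. u (t, y)) has_real_derivative ux (x, y)) (at x)"
    using h z unfolding has_partials_def by auto
  then show "((\<lambda>t. v (t, y)) has_real_derivative vx (x, y)) (at x)"
    using has_field_derivative_transform_within_open[OF _ open_slices(1)[OF S, of y]] z eq by auto
next
  fix x y assume z: "(x, y) \<in> S"
  have "((\<lambda>t. u (x, t)) has_real_derivative uy (x, y)) (at y)"
    using h z unfolding has_partials_def by auto
  then show "((\<lambda>t. v (x, t)) has_real_derivative vy (x, y)) (at y)"
    using has_field_derivative_transform_within_open[OF _ open_slices(2)[OF S, of x]] z eq by auto
qed

lemma has_partials_affine:
  assumes h: "has_partials S u ux uy"
    and T: "\<And>x y. (x, y) \<in> T \<Longrightarrow> (c * x + d, e * y + k) \<in> S"
  shows "has_partials T (\<lambda>(x, y). u (c * x + d, e * y + k))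
    (\<lambda>(x, y). c * ux (c * x + d, e * y + k)) (\<lambda>(x, y). e * uy (c * x + d, e * y + k))"
  unfolding has_partials_def
proof (intro conjI allI impI)
  have "continuous_on T (\<lambda>z. u (c * fst z + d, e * snd z + k))"
    by (rule continuous_on_compose2[of S u]) (use h T in \<open>auto simp: has_partials_def intro!: continuous_intros\<close>)
  then show "continuous_on T (\<lambda>(x, y). u (c * x + d, e * y + k))" by (simp add: case_prod_unfold)
next
  fix x y assume z: "(x, y) \<in> T"
  have "((\<lambda>t. u (t, e * y + k)) has_real_derivative ux (c * x + d, e * y + k)) (at (c * x + d))"
    using h T[OF z] unfolding has_partials_def by auto
  moreover have "((\<lambda>t. c * t + d) has_real_derivative c) (at x)"
    by (auto intro!: derivative_eq_intros)
  ultimately have "((\<lambda>t. u (c * t + d, e * y + k)) has_real_derivative ux (c * x + d, e * y + k) * c) (at x)"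
    by (rule DERIV_chain2)
  then
  show "((\<lambda>t. case (t, y) of (x, y) \<Rightarrow> u (c * x + d, e * y + k)) has_real_derivative
          (case (x, y) of (x, y) \<Rightarrow> c * ux (c * x + d, e * y + k))) (at x)"
    by (simp add: mult.commute)
next
  fix x y assume z: "(x, y) \<in> T"
  have "((\<lambda>t. u (c * x + d, t)) has_real_derivative uy (c * x + d, e * y + k)) (at (e * y + k))"
    using h T[OF z] unfolding has_partials_def by auto
  moreover have "((\<lambda>t. e * t + k) has_real_derivative e) (at y)"
    by (auto intro!: derivative_eq_intros)
  ultimately have "((\<lambda>t. u (c * x + d, e * t + k)) has_real_derivative uy (c * x + d, e * y + k) * e) (at y)"
    by (rule DERIV_chain2)
  then
  show "((\<lambda>t. case (x, t) of (x, y) \<Rightarrow> u (c * x + d, e * y + k)) has_real_derivative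
          (case (x, y) of (x, y) \<Rightarrow> e * uy (c * x + d, e * y + k))) (at y)"
    by (simp add: mult.commute)
qed

lemma continuous_on_affine_pair:
  assumes "continuous_on S (u :: real \<times> real \<Rightarrow> real)"
    and T: "\<And>x y. (x, y) \<in> T \<Longrightarrow> (c * x + d, e * y + k) \<in> S"
  shows "continuous_on T (\<lambda>(x, y). u (c * x + d, e * y + k))"
proof -
  have "continuous_on T (\<lambda>z. u (c * fst z + d, e * snd z + k))"
    by (rule continuous_on_compose2[of S u]) (use assms in \<open>auto intro!: continuous_intros\<close>)
  then show ?thesis by (simp add: case_prod_unfold)
qed

lemma has_partials_swap:
  assumes h: "has_partials S u ux uy" and T: "\<And>x y. (x, y) \<in> T \<Longrightarrow> (y, x) \<in> S"
  shows "has_partials T (\<lambda>(x, y). u (y, x)) (\<lambda>(x, y). uy (y, x)) (\<lambda>(x, y). ux (y, x))"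
proof -
  have "continuous_on T (\<lambda>z. u (snd z, fst z))"
    by (rule continuous_on_compose2[of S u]) (use h T in \<open>auto simp: has_partials_def intro!: continuous_intros\<close>)
  then show ?thesis using h T by (auto simp: has_partials_def case_prod_unfold)
qed

lemma continuous_on_swap_pair:
  assumes "continuous_on S (u :: real \<times> real \<Rightarrow> real)" and T: "\<And>x y. (x, y) \<in> T \<Longrightarrow> (y, x) \<in> S"
  shows "continuous_on T (\<lambda>(x, y). u (y, x))"
proof -
  have "continuous_on T (\<lambda>z. u (snd z, fst z))"
    by (rule continuous_on_compose2[of S u]) (use assms in \<open>auto intro!: continuous_intros\<close>)
  then show ?thesis by (simp add: case_prod_unfold)
qed

lemma C2_laplacian_lin:
  assumes "C2_laplacian S u F" "C2_laplacian S v G"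
  shows "C2_laplacian S (\<lambda>z. a * u z + b * v z) (\<lambda>z. a * F z + b * G z)"
proof -
  from assms(1) obtain ux uy uxx uxy uyx uyy where u:
    "has_partials S u ux uy" "has_partials S ux uxx uxy" "has_partials S uy uyx uyy"
    "continuous_on S uxx" "continuous_on S uxy" "continuous_on S uyx" "continuous_on S uyy"
    "\<And>z. z \<in> S \<Longrightarrow> uxx z + uyy z = F z" unfolding C2_laplacian_def by auto
  from assms(2) obtain vx vy vxx vxy vyx vyy where v:
    "has_partials S v vx vy" "has_partials S vx vxx vxy" "has_partials S vy vyx vyy"
    "continuous_on S vxx" "continuous_on S vxy" "continuous_on S vyx" "continuous_on S vyy"
    "\<And>z. z \<in> S \<Longrightarrow> vxx z + vyy z = G z" unfolding C2_laplacian_def by auto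
  have eq: "(a * uxx z + b * vxx z) + (a * uyy z + b * vyy z) = a * F z + b * G z" if "z \<in> S" for z
    unfolding u(8)[OF that, symmetric] v(8)[OF that, symmetric] by (simp add: algebra_simps)
  show ?thesis unfolding C2_laplacian_def
    by (rule exI[of _ "\<lambda>z. a * ux z + b * vx z"], rule exI[of _ "\<lambda>z. a * uy z + b * vy z"],
        rule exI[of _ "\<lambda>z. a * uxx z + b * vxx z"], rule exI[of _ "\<lambda>z. a * uxy z + b * vxy z"],
        rule exI[of _ "\<lambda>z. a * uyx z + b * vyx z"], rule exI[of _ "\<lambda>z. a * uyy z + b * vyy z"])
      (use u v eq in \<open>auto intro!: continuous_intros has_partials_lin\<close>)
qed

lemma C2_laplacian_add:
  assumes "C2_laplacian S u F" "C2_laplacian S v G"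
  shows "C2_laplacian S (\<lambda>z. u z + v z) (\<lambda>z. F z + G z)"
  using C2_laplacian_lin[OF assms, of 1 1] by simp

lemma C2_laplacian_diff:
  assumes "C2_laplacian S u F" "C2_laplacian S v G"
  shows "C2_laplacian S (\<lambda>z. u z - v z) (\<lambda>z. F z - G z)"
  using C2_laplacian_lin[OF assms, of 1 "-1"] by simp

lemma C2_laplacian_cong:
  assumes S: "open S" and h: "C2_laplacian S u F"
    and eq: "\<And>z. z \<in> S \<Longrightarrow> v z = u z" "\<And>z. z \<in> S \<Longrightarrow> G z = F z"
  shows "C2_laplacian S v G"
proof -
  from h obtain ux uy uxx uxy uyx uyy where u:
    "has_partials S u ux uy" "has_partials S ux uxx uxy" "has_partials S uy uyx uyy"
    "continuous_on S uxx" "continuous_on S uxy" "continuous_on S uyx" "continuous_on S uyy"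
    "\<And>z. z \<in> S \<Longrightarrow> uxx z + uyy z = F z" unfolding C2_laplacian_def by auto
  have "has_partials S v ux uy" using has_partials_cong[OF S u(1)] eq by auto
  then show ?thesis unfolding C2_laplacian_def using u eq by metis
qed

text \<open>Since \<open>c\<close> and \<open>e\<close> are 1 or -1, the chain rule leaves pure
  second derivatives unchanged, so the Laplacian commutes with the map. This covers the translation
  of a rectangle to the origin and reflections.\<close>

lemma C2_laplacian_affine:
  assumes h: "C2_laplacian S u F" and ce: "c * c = 1" "e * e = (1::real)"
    and T: "\<And>x y. (x, y) \<in> T \<Longrightarrow> (c * x + d, e * y + k) \<in> S"
  shows "C2_laplacian T (\<lambda>(x, y). u (c * x + d, e * y + k)) (\<lambda>(x, y). F (c * x + d, e * y + k))"
proof -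
  from h obtain ux uy uxx uxy uyx uyy where u:
    "has_partials S u ux uy" "has_partials S ux uxx uxy" "has_partials S uy uyx uyy"
    "continuous_on S uxx" "continuous_on S uxy" "continuous_on S uyx" "continuous_on S uyy"
    "\<And>z. z \<in> S \<Longrightarrow> uxx z + uyy z = F z" unfolding C2_laplacian_def by auto
  \<comment> \<open>The pullback of \<open>w\<close>, scaled by \<open>r\<close>. The scalar
    collects the chain rule factors, so one rule \<open>P\<close> serves for first and second
    derivatives.\<close>
  define L where "L r w = (\<lambda>(x, y). r * w (c * x + d, e * y + k) :: real)" for r :: real and w :: "real \<times> real \<Rightarrow> real"
  have P: "has_partials T (L r w) (L (r * c) wx) (L (r * e) wy)" if "has_partials S w wx wy" for r w wx wy
    using has_partials_lin[OF has_partials_affine[OF that T, of T] has_partials_affine[OF that T, of T], of r 0]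
    by (simp add: L_def case_prod_unfold mult.assoc)
  have C: "continuous_on T (L r w)" if "continuous_on S w" for r w
    using continuous_on_mult[OF continuous_on_const[of _ r] continuous_on_affine_pair[OF that T]]
    by (simp add: L_def case_prod_unfold)
  have Leq: "L (1 * c * c) uxx z + L (1 * e * e) uyy z = (\<lambda>(x, y). F (c * x + d, e * y + k)) z" if "z \<in> T" for z
    using that T u(8) ce by (auto simp: L_def split: prod.splits)
  have "C2_laplacian T (L 1 u) (\<lambda>(x, y). F (c * x + d, e * y + k))"
    unfolding C2_laplacian_def
    by (rule exI[of _ "L (1 * c) ux"], rule exI[of _ "L (1 * e) uy"],
        rule exI[of _ "L (1 * c * c) uxx"], rule exI[of _ "L (1 * c * e) uxy"],
        rule exI[of _ "L (1 * e * c) uyx"], rule exI[of _ "L (1 * e * e) uyy"],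
        intro conjI P C u ballI Leq)
  then show ?thesis by (simp add: L_def)
qed

lemma C2_laplacian_swap:
  assumes h: "C2_laplacian S u F" and T: "\<And>x y. (x, y) \<in> T \<Longrightarrow> (y, x) \<in> S"
  shows "C2_laplacian T (\<lambda>(x, y). u (y, x)) (\<lambda>(x, y). F (y, x))"
proof -
  from h obtain ux uy uxx uxy uyx uyy where u:
    "has_partials S u ux uy" "has_partials S ux uxx uxy" "has_partials S uy uyx uyy"
    "continuous_on S uxx" "continuous_on S uxy" "continuous_on S uyx" "continuous_on S uyy"
    "\<And>z. z \<in> S \<Longrightarrow> uxx z + uyy z = F z" unfolding C2_laplacian_def by auto
  have Leq: "(\<lambda>(x, y). uyy (y, x)) z + (\<lambda>(x, y). uxx (y, x)) z = (\<lambda>(x, y). F (y, x)) z" if "z \<in> T" for z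
    using that T u(8) by (auto simp: add.commute split: prod.splits)
  show ?thesis
    unfolding C2_laplacian_def
    by (rule exI[of _ "\<lambda>(x, y). uy (y, x)"], rule exI[of _ "\<lambda>(x, y). ux (y, x)"],
        rule exI[of _ "\<lambda>(x, y). uyy (y, x)"], rule exI[of _ "\<lambda>(x, y). uyx (y, x)"],
        rule exI[of _ "\<lambda>(x, y). uxy (y, x)"], rule exI[of _ "\<lambda>(x, y). uxx (y, x)"],
        intro conjI has_partials_swap[of S] continuous_on_swap_pair[of S] u ballI Leq T)
qed

section \<open>Passage between explicit witnesses and the iterated derivatives \<open>pd1\<close>,
  \<open>pd2\<close>\<close>

lemma has_partials_pd:
  assumes "has_partials S u ux uy" "z \<in> S"
  shows "pd1 u z = ux z" "pd2 u z = uy z"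
  using assms unfolding has_partials_def pd1_def pd2_def
  by (auto split: prod.splits intro!: DERIV_imp_deriv)

lemma has_partials_has_pds_on:
  assumes "has_partials S u ux uy"
  shows "has_pds_on S u"
  using assms unfolding has_partials_def has_pds_on_def field_differentiable_def by auto

text \<open>On all of the open set \<open>pd1 u\<close> and \<open>pd2 u\<close> coincide with the
  witnesses, so they inherit the derivatives of the witnesses and can be differentiated once
  more.\<close>

lemma C2_laplacian_imp_Ck_open:
  assumes S: "open S" and h: "C2_laplacian S u F"
  shows "Ck_open 2 S u" "\<And>z. z \<in> S \<Longrightarrow> laplacian u z = F z"
proof -
  from h obtain ux uy uxx uxy uyx uyy where u:
    "has_partials S u ux uy" "has_partials S ux uxx uxy" "has_partials S uy uyx uyy"
    "continuous_on S uxx" "continuous_on S uxy" "continuous_on S uyx" "continuous_on S uyy"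
    "\<And>z. z \<in> S \<Longrightarrow> uxx z + uyy z = F z" unfolding C2_laplacian_def by auto
  have p1: "has_partials S (pd1 u) uxx uxy"
    by (rule has_partials_cong[OF S u(2)]) (use has_partials_pd[OF u(1)] in auto)
  have p2: "has_partials S (pd2 u) uyx uyy"
    by (rule has_partials_cong[OF S u(3)]) (use has_partials_pd[OF u(1)] in auto)
  have "continuous_on S (pd1 (pd1 u))" "continuous_on S (pd2 (pd1 u))"
    "continuous_on S (pd1 (pd2 u))" "continuous_on S (pd2 (pd2 u))"
    using u(4-7) has_partials_pd[OF p1] has_partials_pd[OF p2] by (simp_all cong: continuous_on_cong)
  then show "Ck_open 2 S u"
    using has_partials_has_pds_on[OF u(1)] has_partials_has_pds_on[OF p1] has_partials_has_pds_on[OF p2] u(1) p1 p2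
    by (simp add: numeral_2_eq_2 has_partials_def)
  show "laplacian u z = F z" if "z \<in> S" for z
    using has_partials_pd[OF p1 that] has_partials_pd[OF p2 that] u(8)[OF that] by (simp add: laplacian_def)
qed

lemma has_pds_on_has_partials:
  assumes "has_pds_on S u" "continuous_on S u"
  shows "has_partials S u (pd1 u) (pd2 u)"
  using assms unfolding has_pds_on_def has_partials_def pd1_def pd2_def
  by (auto simp: DERIV_deriv_iff_field_differentiable)

lemma Ck_open_imp_C2_laplacian:
  assumes "Ck_open 2 S u"
  shows "C2_laplacian S u (laplacian u)"
proof -
  have h: "has_partials S u (pd1 u) (pd2 u)" "has_partials S (pd1 u) (pd1 (pd1 u)) (pd2 (pd1 u))"
    "has_partials S (pd2 u) (pd1 (pd2 u)) (pd2 (pd2 u))"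
    "continuous_on S (pd1 (pd1 u))" "continuous_on S (pd2 (pd1 u))"
    "continuous_on S (pd1 (pd2 u))" "continuous_on S (pd2 (pd2 u))"
    using assms by (auto simp: numeral_2_eq_2 intro!: has_pds_on_has_partials)
  show ?thesis
    unfolding C2_laplacian_def
    by (rule exI[of _ "pd1 u"], rule exI[of _ "pd2 u"], rule exI[of _ "pd1 (pd1 u)"], rule exI[of _ "pd2 (pd1 u)"],
      rule exI[of _ "pd1 (pd2 u)"], rule exI[of _ "pd2 (pd2 u)"]) (use h in \<open>simp add: laplacian_def\<close>)
qed

section \<open>Sine series\<close>

text \<open>The index is shifted: \<open>n\<close> stands for the sine with n + 1 half waves on the
  interval from 0 to \<open>b\<close>, so that every frequency is positive and the zero mode does
  not occur.\<close>

definition nu :: "real \<Rightarrow> nat \<Rightarrow> real"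
  where "nu b n = real (Suc n) * pi / b"

definition sine_coeff :: "real \<Rightarrow> (real \<Rightarrow> real) \<Rightarrow> nat \<Rightarrow> real"
  where "sine_coeff b d n = 2 / b * integral {0..b} (\<lambda>y. d y * sin (nu b n * y))"

definition sine_sum :: "real \<Rightarrow> (nat \<Rightarrow> real) \<Rightarrow> real \<Rightarrow> real"
  where "sine_sum b a y = (\<Sum>n. a n * sin (nu b n * y))"

lemma nu_pos: "b > 0 \<Longrightarrow> nu b n > 0"
  by (simp add: nu_def)

lemma sin_nu_end [simp]: "b \<noteq> 0 \<Longrightarrow> sin (nu b n * b) = 0"
  unfolding nu_def by (metis nonzero_divide_eq_eq sin_npi)

text \<open>The identity sin (n t) cos t = (sin ((n + 1) t) + sin ((n - 1) t)) / 2 trades one power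
  of the cosine for a shift of the frequency in both directions. Orthogonality to all sines thus
  extends to their products with powers of the cosine; the induction needs all \<open>n\<close> at
  once.\<close>

lemma integral_sin_cos_power_eq_0:
  fixes b k :: real and d :: "real \<Rightarrow> real"
  assumes d: "continuous_on {0..b} d"
    and coef0: "\<And>n. integral {0..b} (\<lambda>y. d y * sin (real (Suc n) * k * y)) = 0"
  shows "integral {0..b} (\<lambda>y. d y * (sin (real n * k * y) * cos (k * y) ^ j)) = 0"
proof (induction j arbitrary: n)
  case 0
  show ?case using assms(2)[of "n - 1"] by (cases n) auto
next
  case (Suc j)
  show ?case
  proof (cases n)
    case (Suc m)
    have sc: "sin (real n * k * y) * cos (k * y) ^ Suc j =
       (sin (real (Suc (Suc m)) * k * y) * cos (k * y) ^ j + sin (real m * k * y) * cos (k * y) ^ j) / 2" for y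
    proof -
      have 1: "real (Suc (Suc m)) * k * y = real n * k * y + k * y" "real m * k * y = real n * k * y - k * y"
        using Suc by (simp_all add: algebra_simps)
      show ?thesis unfolding 1 sin_add sin_diff by (simp add: algebra_simps)
    qed
    have "integral {0..b} (\<lambda>y. d y * (sin (real n * k * y) * cos (k * y) ^ Suc j)) =
      integral {0..b} (\<lambda>y. 1/2 * (d y * (sin (real (Suc (Suc m)) * k * y) * cos (k * y) ^ j)) +
        1/2 * (d y * (sin (real m * k * y) * cos (k * y) ^ j)))"
      unfolding sc by (simp add: field_simps)
    also have "\<dots> = integral {0..b} (\<lambda>y. 1/2 * (d y * (sin (real (Suc (Suc m)) * k * y) * cos (k * y) ^ j))) +
        integral {0..b} (\<lambda>y. 1/2 * (d y * (sin (real m * k * y) * cos (k * y) ^ j)))"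
      by (intro integral_add integrable_continuous_real continuous_intros d)
    also have "\<dots> = 0" unfolding integral_mult_right Suc.IH by simp
    finally show ?thesis .
  qed simp
qed

text \<open>Orthogonality extends to sin (k y) p (cos (k y)) for every polynomial p. As y runs
  through the interval, cos (k y) runs bijectively through that from -1 to 1, so by Weierstrass
  \<open>d\<close> is a uniform limit of such p (cos (k y)). Hence the integral of d^2 sin (k y)
  vanishes, and the weight is positive inside.\<close>

lemma sine_complete:
  assumes b: "b > 0" and d: "continuous_on {0..b} d"
    and coef0: "\<And>n. integral {0..b} (\<lambda>y. d y * sin (nu b n * y)) = 0"
    and y: "y \<in> {0<..<b}"
  shows "d y = 0"
proof -
  define k where "k = pi / b"
  have k: "k > 0" "k * b = pi" using b by (auto simp: k_def)
  have ky: "0 \<le> k * y \<and> k * y \<le> pi" if "y \<in> {0..b}" for y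
    using that k b by (auto simp: k_def field_simps)
  have coef0': "integral {0..b} (\<lambda>y. d y * sin (real (Suc n) * k * y)) = 0" for n
    using coef0[of n] by (simp add: nu_def k_def)
  have poly0: "integral {0..b} (\<lambda>y. d y * sin (k * y) * p (cos (k * y))) = 0"
    if p: "real_polynomial_function p" for p
  proof -
    from p obtain a N where p: "p = (\<lambda>x. \<Sum>i\<le>N. a i * x ^ i)"
      unfolding real_polynomial_function_iff_sum by auto
    have "integral {0..b} (\<lambda>y. d y * sin (k * y) * p (cos (k * y))) =
      integral {0..b} (\<lambda>y. \<Sum>i\<le>N. a i * (d y * (sin (real 1 * k * y) * cos (k * y) ^ i)))"
      unfolding p by (simp add: sum_distrib_left algebra_simps)
    also have "\<dots> = (\<Sum>i\<le>N. integral {0..b} (\<lambda>y. a i * (d y * (sin (real 1 * k * y) * cos (k * y) ^ i))))"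
      by (intro integral_sum finite_atMost integrable_continuous_real continuous_intros d)
    also have "\<dots> = 0"
      unfolding integral_mult_right integral_sin_cos_power_eq_0[OF d coef0'] by simp
    finally show ?thesis .
  qed
  obtain B where B: "\<And>y. y \<in> {0..b} \<Longrightarrow> \<bar>d y\<bar> \<le> B" "B > 0"
    using compact_imp_bounded[OF compact_continuous_image[OF d compact_Icc]]
    unfolding bounded_pos by (auto simp del: atLeastAtMost_iff)
  define I where "I = integral {0..b} (\<lambda>y. d y * d y * sin (k * y))"
  have sn: "sin (k * y) \<ge> 0" if "y \<in> {0..b}" for y using ky[OF that] by (auto intro: sin_ge_zero)
  have Ib: "I \<le> e" if e: "e > 0" for e
  proof -
    define \<epsilon> where "\<epsilon> = e / (B * b)"
    have \<epsilon>: "\<epsilon> > 0" using e B b by (simp add: \<epsilon>_def)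
    have ce: "continuous_on {-1..1} (\<lambda>t. d (arccos t / k))"
      by (rule continuous_on_compose2[OF d]) 
        (use k b in \<open>auto intro!: continuous_intros arccos_lbound divide_nonneg_pos simp: divide_le_eq mult.commute[of b] arccos_ubound\<close>)
    obtain p where p: "real_polynomial_function p" "\<And>t. t \<in> {-1..1} \<Longrightarrow> \<bar>d (arccos t / k) - p t\<bar> < \<epsilon>"
      using Stone_Weierstrass_real_polynomial_function[OF compact_Icc ce \<epsilon>] by metis
    have "continuous_on UNIV p"
      using p(1) real_polynomial_function_eq continuous_on_polymonial_function by blast
    then have pc: "continuous_on {0..b} (\<lambda>y. p (cos (k * y)))"
      by (rule continuous_on_compose2) (auto intro!: continuous_intros)
    have close: "\<bar>d y - p (cos (k * y))\<bar> < \<epsilon>" if "y \<in> {0..b}" for y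
      using p(2)[of "cos (k * y)"] ky[OF that] k by (simp add: arccos_cos)
    \<comment> \<open>Subtracting an integral that is zero replaces one factor \<open>d y\<close> by
      the approximation error.\<close>
    have "I = I - integral {0..b} (\<lambda>y. d y * sin (k * y) * p (cos (k * y)))" by (simp add: poly0 p)
    also have "\<dots> = integral {0..b} (\<lambda>y. d y * d y * sin (k * y) - d y * sin (k * y) * p (cos (k * y)))"
      unfolding I_def by (intro integral_diff[symmetric] integrable_continuous_real continuous_intros d pc)
    also have "\<dots> = integral {0..b} (\<lambda>y. d y * sin (k * y) * (d y - p (cos (k * y))))"
      by (simp add: algebra_simps)
    also have "\<dots> \<le> integral {0..b} (\<lambda>y. B * \<epsilon>)"
    proof (intro integral_le integrable_continuous_real continuous_intros d pc)
      fix y assume y: "y \<in> {0..b}"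
      have "d y * sin (k * y) * (d y - p (cos (k * y))) \<le> \<bar>d y\<bar> * \<bar>sin (k * y)\<bar> * \<bar>d y - p (cos (k * y))\<bar>"
        by (metis abs_ge_self abs_mult)
      also have "\<dots> \<le> B * 1 * \<epsilon>"
        using B y close[OF y] by (intro mult_mono) auto
      finally show "d y * sin (k * y) * (d y - p (cos (k * y))) \<le> B * \<epsilon>" by simp
    qed
    also have "\<dots> = e" using b B by (simp add: \<epsilon>_def)
    finally show ?thesis .
  qed
  then have "I \<le> 0" by (metis dense_ge)
  moreover have "I \<ge> 0" unfolding I_def
    by (rule integral_nonneg) (auto intro!: integrable_continuous_real continuous_intros d simp: sn)
  ultimately have "I = 0" by simp
  then have "d y * d y * sin (k * y) = 0"
    unfolding I_def using y
    by (subst (asm) integral_eq_0_iff) (auto intro!: continuous_intros d b simp: sn)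
  moreover have "sin (k * y) > 0"
    using y k b by (intro sin_gt_zero) (auto simp: k_def field_simps)
  ultimately show ?thesis by simp
qed

section \<open>Orthogonality of the sines and recovery of a function from its coefficients\<close>

lemma integral_cos_int_multiple:
  assumes b: "b > 0"
  shows "integral {0..b} (\<lambda>y. cos (of_int j * (pi / b) * y)) = (if j = 0 then b else 0)"
proof (cases "j = 0")
  case False
  define c where "c = of_int j * (pi / b)"
  have c: "c \<noteq> 0" using False b by (simp add: c_def)
  have "((\<lambda>y. cos (c * y)) has_integral (sin (c * b) / c - sin (c * 0) / c)) {0..b}"
    by (rule fundamental_theorem_of_calculus)
      (use b c in \<open>auto intro!: derivative_eq_intros simp flip: has_real_derivative_iff_has_vector_derivative\<close>)
  moreover have "sin (c * b) = 0"
    using b by (simp add: c_def sin_zero_iff_int2)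
  ultimately show ?thesis using False by (simp add: c_def integral_unique)
qed (use b in simp)

lemma integral_sin_sin:
  assumes b: "b > 0"
  shows "integral {0..b} (\<lambda>y. sin (nu b n * y) * sin (nu b m * y)) = (if n = m then b / 2 else 0)"
proof -
  have "sin (nu b n * y) * sin (nu b m * y) =
      1/2 * cos (of_int (int n - int m) * (pi / b) * y) - 1/2 * cos (of_int (int n + int m + 2) * (pi / b) * y)" for y
    unfolding sin_times_sin by (simp add: nu_def algebra_simps add_divide_distrib diff_divide_distrib)
  then have "integral {0..b} (\<lambda>y. sin (nu b n * y) * sin (nu b m * y)) =
    integral {0..b} (\<lambda>y. 1/2 * cos (of_int (int n - int m) * (pi / b) * y) - 1/2 * cos (of_int (int n + int m + 2) * (pi / b) * y))"
    by presburger
  also have "\<dots> = integral {0..b} (\<lambda>y. 1/2 * cos (of_int (int n - int m) * (pi / b) * y)) -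
       integral {0..b} (\<lambda>y. 1/2 * cos (of_int (int n + int m + 2) * (pi / b) * y))"
    by (intro integral_diff integrable_continuous_real continuous_intros)
  also have "\<dots> = (if n = m then b / 2 else 0)"
    unfolding integral_mult_right integral_cos_int_multiple[OF b] by auto
  finally show ?thesis .
qed

lemma summable_sine_terms:
  assumes "summable (\<lambda>n. \<bar>a n\<bar>)"
  shows "summable (\<lambda>n. a n * sin (nu b n * y))"
  by (rule summable_comparison_test'[OF assms, of 0]) (simp add: abs_mult mult_left_le)

lemma uniform_limit_sine_sum:
  assumes "summable (\<lambda>n. \<bar>a n\<bar>)"
  shows "uniform_limit A (\<lambda>N y. \<Sum>n<N. a n * sin (nu b n * y)) (sine_sum b a) sequentially"
  unfolding sine_sum_def[abs_def]
  by (rule Weierstrass_m_test[OF _ assms]) (simp add: abs_mult mult_left_le)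

lemma continuous_on_sine_sum:
  assumes "summable (\<lambda>n. \<bar>a n\<bar>)"
  shows "continuous_on A (sine_sum b a)"
  by (rule uniform_limit_theorem[OF _ uniform_limit_sine_sum[OF assms]])
    (auto intro!: always_eventually continuous_intros)

text \<open>Uniform convergence permits integration of the partial sums; by orthogonality these
  integrals are constant as soon as the index \<open>m\<close> is included.\<close>

lemma sine_coeff_sine_sum:
  assumes b: "b > 0" and a: "summable (\<lambda>n. \<bar>a n\<bar>)"
  shows "sine_coeff b (sine_sum b a) m = a m"
proof -
  define f where "f N y = (\<Sum>n<N. a n * sin (nu b n * y)) * sin (nu b m * y)" for N y
  have u: "uniform_limit {0..b} f (\<lambda>y. sine_sum b a y * sin (nu b m * y)) sequentially"
    unfolding f_def
    by (intro uniform_lim_mult uniform_limit_sine_sum a uniform_limit_const)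
      (auto intro!: compact_imp_bounded compact_continuous_image continuous_on_sine_sum a continuous_intros)
  obtain I J where IJ: "\<And>N. (f N has_integral I N) {0..b}"
    "((\<lambda>y. sine_sum b a y * sin (nu b m * y)) has_integral J) {0..b}" "I \<longlonglongrightarrow> J"
    by (rule uniform_limit_integral[OF u]) (auto simp: f_def intro!: continuous_intros)
  have "I N = a m * (b / 2)" if "N > m" for N
  proof -
    have "I N = integral {0..b} (f N)" by (rule integral_unique[OF IJ(1), symmetric])
    also have "\<dots> = integral {0..b} (\<lambda>y. \<Sum>n<N. a n * (sin (nu b n * y) * sin (nu b m * y)))"
      unfolding f_def by (simp add: sum_distrib_right mult.assoc)
    also have "\<dots> = (\<Sum>n<N. integral {0..b} (\<lambda>y. a n * (sin (nu b n * y) * sin (nu b m * y))))"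
      by (intro integral_sum finite_lessThan integrable_continuous_real continuous_intros)
    also have "\<dots> = a m * (b / 2)"
      unfolding integral_mult_right integral_sin_sin[OF b] using that by (simp add: if_distrib cong: if_cong)
    finally show ?thesis .
  qed
  then have "I \<longlonglongrightarrow> a m * (b / 2)"
    by (intro tendsto_eventually) (auto simp: eventually_sequentially intro!: exI[of _ "Suc m"])
  with IJ(3) have "J = a m * (b / 2)" using LIMSEQ_unique by blast
  then show ?thesis using IJ(2) b by (simp add: sine_coeff_def integral_unique field_simps)
qed

lemma sine_sum_ends [simp]: "sine_sum b a 0 = 0" "b \<noteq> 0 \<Longrightarrow> sine_sum b a b = 0"
  by (simp_all add: sine_sum_def)

text \<open>The sum of the series is continuous and has the coefficients of \<open>d\<close>, so
  completeness identifies the two inside the interval. At the ends both vanish, by the assumption on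
  \<open>d\<close> and because every sine does.\<close>

lemma sine_sum_sine_coeff:
  assumes b: "b > 0" and d: "continuous_on {0..b} d" and ends: "d 0 = 0" "d b = 0"
    and s: "summable (\<lambda>n. \<bar>sine_coeff b d n\<bar>)" and y: "y \<in> {0..b}"
  shows "sine_sum b (sine_coeff b d) y = d y"
proof -
  let ?g = "sine_sum b (sine_coeff b d)"
  have "integral {0..b} (\<lambda>y. (?g y - d y) * sin (nu b n * y)) = 0" for n
  proof -
    have "integral {0..b} (\<lambda>y. (?g y - d y) * sin (nu b n * y)) =
      integral {0..b} (\<lambda>y. ?g y * sin (nu b n * y)) - integral {0..b} (\<lambda>y. d y * sin (nu b n * y))"
      unfolding left_diff_distrib
      by (intro integral_diff integrable_continuous_real continuous_intros d continuous_on_sine_sum s)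
    also have "\<dots> = 0" using sine_coeff_sine_sum[OF b s, of n] b unfolding sine_coeff_def[of b ?g] sine_coeff_def[of b d n] by simp
    finally show ?thesis .
  qed
  from sine_complete[OF b _ this]
  have "?g y - d y = 0" if "y \<in> {0<..<b}" using that
    by (auto intro!: continuous_intros d continuous_on_sine_sum s)
  then show ?thesis using y ends b by (cases "y = 0 \<or> y = b") auto
qed

section \<open>Size of sine coefficients and density of sine sums\<close>

lemma sine_coeff_bound:
  assumes b: "b > 0" and d: "continuous_on {0..b} d" and B: "\<And>y. y \<in> {0..b} \<Longrightarrow> \<bar>d y\<bar> \<le> B"
  shows "\<bar>sine_coeff b d n\<bar> \<le> 2 * B"
proof -
  have B0: "0 \<le> B" using B[of 0] b by auto
  have "((\<lambda>y. d y * sin (nu b n * y)) has_integral integral {0..b} (\<lambda>y. d y * sin (nu b n * y))) (cbox 0 b)"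
    by (simp add: integrable_integral integrable_continuous_real continuous_intros d)
  then have "norm (integral {0..b} (\<lambda>y. d y * sin (nu b n * y))) \<le> B * measure lborel (cbox 0 b)"
  proof (rule has_integral_bound[OF B0])
    fix y assume "y \<in> cbox 0 b"
    then have "\<bar>d y\<bar> * \<bar>sin (nu b n * y)\<bar> \<le> B * 1" using B B0 by (intro mult_mono) auto
    then show "norm (d y * sin (nu b n * y)) \<le> B" by (simp add: abs_mult)
  qed
  then show ?thesis using b by (simp add: sine_coeff_def abs_mult field_simps)
qed

text \<open>Both integrations by parts are done at once: with N the frequency, - d cos (N y) / N + e
  sin (N y) / N^2 is an antiderivative of d sin (N y) + q sin (N y) / N^2 and vanishes at both ends.
  The derivatives are assumed inside the interval only, in keeping with
  \<open>Ck_closure\<close>.\<close>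

lemma sine_coeff_parts:
  assumes b: "b > 0" and d: "continuous_on {0..b} d" and ends: "d 0 = 0" "d b = 0"
    and e: "continuous_on {0..b} e" and q: "continuous_on {0..b} q"
    and d': "\<And>y. y \<in> {0<..<b} \<Longrightarrow> (d has_real_derivative e y) (at y)"
    and e': "\<And>y. y \<in> {0<..<b} \<Longrightarrow> (e has_real_derivative q y) (at y)"
  shows "sine_coeff b d n = - sine_coeff b q n / (nu b n)\<^sup>2"
proof -
  define N where "N = nu b n"
  have N: "N > 0" using b by (simp add: N_def nu_pos)
  have sN: "sin (N * b) = 0" using b by (simp add: N_def)
  have "((\<lambda>y. d y * sin (N * y) + q y * sin (N * y) / N\<^sup>2) has_integral
     (- d b * cos (N * b) / N + e b * sin (N * b) / N\<^sup>2) - (- d 0 * cos (N * 0) / N + e 0 * sin (N * 0) / N\<^sup>2)) {0..b}"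
  proof (rule fundamental_theorem_of_calculus_interior)
    show "continuous_on {0..b} (\<lambda>y. - d y * cos (N * y) / N + e y * sin (N * y) / N\<^sup>2)"
      using N by (intro continuous_intros d e) auto
    fix y assume y: "y \<in> {0<..<b}"
    show "((\<lambda>y. - d y * cos (N * y) / N + e y * sin (N * y) / N\<^sup>2) has_vector_derivative
        d y * sin (N * y) + q y * sin (N * y) / N\<^sup>2) (at y)"
      unfolding has_real_derivative_iff_has_vector_derivative[symmetric]
      using N by (auto intro!: derivative_eq_intros d'[OF y] e'[OF y] simp: field_simps power2_eq_square)
  qed (use b in simp)
  then have "integral {0..b} (\<lambda>y. d y * sin (N * y) + q y * sin (N * y) / N\<^sup>2) = 0"
    using ends sN by (simp add: integral_unique)
  moreover have "integral {0..b} (\<lambda>y. d y * sin (N * y) + q y * sin (N * y) / N\<^sup>2) =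
    integral {0..b} (\<lambda>y. d y * sin (N * y)) + integral {0..b} (\<lambda>y. q y * sin (N * y) / N\<^sup>2)"
    using N by (intro integral_add integrable_continuous_real continuous_intros d q) auto
  ultimately show ?thesis using b N unfolding sine_coeff_def N_def[symmetric]
    by (simp add: field_simps add_eq_0_iff)
qed

lemma summable_inverse_nu_sq:
  assumes "b > 0"
  shows "summable (\<lambda>n. C / (nu b n)\<^sup>2)"
proof -
  have "summable (\<lambda>n. C * b\<^sup>2 / pi\<^sup>2 * inverse (real (Suc n) ^ 2))"
    by (intro summable_mult summable_ignore_initial_segment[of _ 1, simplified]) (use inverse_power_summable[of 2] in simp)
  then show ?thesis by (simp add: nu_def power_divide power_mult_distrib divide_inverse mult_ac)
qed

text \<open>A polynomial close to \<open>g\<close> is nearly zero at the ends. Subtracting the line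
  through its end values changes it little and makes it vanish there, so two integrations by parts
  give coefficients O(n^-2) and it equals its own sine series.\<close>

lemma sine_sum_dense:
  assumes b: "b > 0" and g: "continuous_on {0..b} g" and ends: "g 0 = 0" "g b = 0" and e: "e > 0"
  obtains a where "summable (\<lambda>n. \<bar>a n\<bar>)" "\<And>y. y \<in> {0..b} \<Longrightarrow> \<bar>g y - sine_sum b a y\<bar> \<le> e"
proof -
  obtain p where p: "real_polynomial_function p" "\<And>y. y \<in> {0..b} \<Longrightarrow> \<bar>g y - p y\<bar> < e / 2"
    using Stone_Weierstrass_real_polynomial_function[OF compact_Icc g, of "e / 2"] e by auto
  obtain p' where p': "real_polynomial_function p'" "\<And>x. (p has_real_derivative p' x) (at x)"
    using has_real_derivative_polynomial_function[OF p(1)] by auto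
  obtain p'' where p'': "real_polynomial_function p''" "\<And>x. (p' has_real_derivative p'' x) (at x)"
    using has_real_derivative_polynomial_function[OF p'(1)] by auto
  have c: "continuous_on A f" if "real_polynomial_function f" for A and f :: "real \<Rightarrow> real"
    using that real_polynomial_function_eq continuous_on_polymonial_function by blast
  define d where "d y = p y - (p 0 * (1 - y / b) + p b * (y / b))" for y
  have dc: "continuous_on {0..b} d" unfolding d_def using b by (intro continuous_intros c p) auto
  have d0: "d 0 = 0" "d b = 0" using b by (auto simp: d_def)
  have parts: "sine_coeff b d n = - sine_coeff b p'' n / (nu b n)\<^sup>2" for n
  proof (rule sine_coeff_parts[OF b dc d0, where e = "\<lambda>y. p' y - (p b - p 0) / b"])
    show "continuous_on {0..b} (\<lambda>y. p' y - (p b - p 0) / b)" using b by (intro continuous_intros c p') auto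
    show "continuous_on {0..b} p''" by (intro c p'')
    fix y
    show "(d has_real_derivative p' y - (p b - p 0) / b) (at y)"
      unfolding d_def[abs_def] using b by (auto intro!: derivative_eq_intros p'(2) simp: field_simps)
    show "((\<lambda>y. p' y - (p b - p 0) / b) has_real_derivative p'' y) (at y)"
      by (auto intro!: derivative_eq_intros p''(2))
  qed
  obtain B where B: "\<And>y. y \<in> {0..b} \<Longrightarrow> \<bar>p'' y\<bar> \<le> B"
    using compact_imp_bounded[OF compact_continuous_image[OF c[OF p''(1)] compact_Icc[of 0 b]]]
    unfolding bounded_pos by (auto simp del: atLeastAtMost_iff)
  have s: "summable (\<lambda>n. \<bar>sine_coeff b d n\<bar>)"
  proof (rule summable_comparison_test'[OF summable_inverse_nu_sq[OF b, of "2 * B"]])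
    fix n
    show "norm \<bar>sine_coeff b d n\<bar> \<le> 2 * B / (nu b n)\<^sup>2"
      using sine_coeff_bound[OF b c[OF p''(1)] B, of n] by (simp add: parts abs_mult divide_right_mono)
  qed
  show ?thesis
  proof (rule that[OF s])
    fix y assume y: "y \<in> {0..b}"
    have "\<bar>p 0 * (1 - y / b) + p b * (y / b)\<bar> \<le> \<bar>p 0\<bar> * \<bar>1 - y / b\<bar> + \<bar>p b\<bar> * \<bar>y / b\<bar>"
      by (metis abs_mult abs_triangle_ineq)
    \<comment> \<open>The end values of \<open>p\<close> are below e / 2 because \<open>g\<close>
      vanishes there; the two weights sum to 1.\<close>
    also have "\<dots> \<le> e / 2 * \<bar>1 - y / b\<bar> + e / 2 * \<bar>y / b\<bar>"
      using p(2)[of 0] p(2)[of b] ends b by (intro add_mono mult_right_mono) auto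
    also have "\<dots> = e / 2" using y b by (auto simp: field_simps)
    finally have "\<bar>p y - d y\<bar> \<le> e / 2" by (simp add: d_def)
    then show "\<bar>g y - sine_sum b (sine_coeff b d) y\<bar> \<le> e"
      unfolding sine_sum_sine_coeff[OF b dc d0 s y] using p(2)[OF y] by linarith
  qed
qed

lemma DERIV_suminf:
  fixes f f' :: "nat \<Rightarrow> real \<Rightarrow> real"
  assumes x: "x \<in> {p<..<q}"
    and f: "\<And>n t. t \<in> {p<..<q} \<Longrightarrow> (f n has_real_derivative f' n t) (at t)"
    and M: "\<And>n t. t \<in> {p<..<q} \<Longrightarrow> \<bar>f' n t\<bar> \<le> M n" "summable M" and s: "summable (\<lambda>n. f n x)"
  shows "((\<lambda>t. \<Sum>n. f n t) has_real_derivative (\<Sum>n. f' n x)) (at x)"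
proof -
  have "uniformly_convergent_on {p<..<q} (\<lambda>n t. \<Sum>i<n. f' i t)"
    by (rule Weierstrass_m_test'[OF _ M(2)]) (use M(1) in auto)
  then show ?thesis
    using has_field_derivative_series'(2)[OF convex_real_interval(8) has_field_derivative_at_within[OF f] _ x s] x by auto
qed

section \<open>Termwise differentiation\<close>

lemma continuous_on_suminf:
  fixes f :: "nat \<Rightarrow> 'a::topological_space \<Rightarrow> real"
  assumes "\<And>n. continuous_on S (f n)" "\<And>n z. z \<in> S \<Longrightarrow> \<bar>f n z\<bar> \<le> M n" "summable M"
  shows "continuous_on S (\<lambda>z. \<Sum>n. f n z)"
  by (rule uniform_limit_theorem[OF _ Weierstrass_m_test[OF _ assms(3)]])
    (use assms in \<open>auto intro!: always_eventually continuous_intros\<close>)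

lemma continuous_on_product_series:
  assumes "\<And>n. continuous_on A (X n)" "\<And>n. continuous_on B (Y n)"
    and "\<And>n x y. x \<in> A \<Longrightarrow> y \<in> B \<Longrightarrow> \<bar>X n x * Y n y\<bar> \<le> M n" and "summable M"
  shows "continuous_on (A \<times> B) (\<lambda>(x, y). \<Sum>n. X n x * Y n y :: real)"
proof -
  have "continuous_on (A \<times> B) (\<lambda>z. \<Sum>n. X n (fst z) * Y n (snd z))"
    by (rule continuous_on_suminf[OF _ _ assms(4)])
      (use assms in \<open>auto intro!: continuous_intros continuous_on_compose2[OF assms(1)] continuous_on_compose2[OF assms(2)]\<close>)
  then show ?thesis by (simp add: case_prod_unfold)
qed

lemma has_partials_product_series:
  fixes X Y X' Y' :: "nat \<Rightarrow> real \<Rightarrow> real"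
  assumes X: "\<And>n x. x \<in> {p<..<q} \<Longrightarrow> (X n has_real_derivative X' n x) (at x)"
    and Y: "\<And>n y. y \<in> {c<..<d} \<Longrightarrow> (Y n has_real_derivative Y' n y) (at y)"
    and M: "summable M" "\<And>n x y. x \<in> {p<..<q} \<Longrightarrow> y \<in> {c<..<d} \<Longrightarrow> \<bar>X n x * Y n y\<bar> \<le> M n"
      "\<And>n x y. x \<in> {p<..<q} \<Longrightarrow> y \<in> {c<..<d} \<Longrightarrow> \<bar>X' n x * Y n y\<bar> \<le> M n"
      "\<And>n x y. x \<in> {p<..<q} \<Longrightarrow> y \<in> {c<..<d} \<Longrightarrow> \<bar>X n x * Y' n y\<bar> \<le> M n"
  shows "has_partials ({p<..<q} \<times> {c<..<d}) (\<lambda>(x, y). \<Sum>n. X n x * Y n y)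
    (\<lambda>(x, y). \<Sum>n. X' n x * Y n y) (\<lambda>(x, y). \<Sum>n. X n x * Y' n y)"
  unfolding has_partials_def
proof (intro conjI allI impI)
  have cX: "continuous_on {p<..<q} (X n)" for n
    by (rule DERIV_continuous_on) (use X in \<open>blast intro: DERIV_subset\<close>)
  have cY: "continuous_on {c<..<d} (Y n)" for n
    by (rule DERIV_continuous_on) (use Y in \<open>blast intro: DERIV_subset\<close>)
  show "continuous_on ({p<..<q} \<times> {c<..<d}) (\<lambda>(x, y). \<Sum>n. X n x * Y n y)"
    by (rule continuous_on_product_series[OF cX cY M(2,1)])
next
  fix x y assume z: "(x, y) \<in> {p<..<q} \<times> {c<..<d}"
  have s: "summable (\<lambda>n. X n x * Y n y)"
    by (rule summable_comparison_test'[OF M(1)]) (use M(2) z in auto)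
  have "((\<lambda>t. \<Sum>n. X n t * Y n y) has_real_derivative (\<Sum>n. X' n x * Y n y)) (at x)"
    by (rule DERIV_suminf[where M = M and p = p and q = q]) (use X M z s in \<open>auto intro!: derivative_eq_intros\<close>)
  then show "((\<lambda>t. case (t, y) of (x, y) \<Rightarrow> \<Sum>n. X n x * Y n y) has_real_derivative
      (case (x, y) of (x, y) \<Rightarrow> \<Sum>n. X' n x * Y n y)) (at x)" by simp
next
  fix x y assume z: "(x, y) \<in> {p<..<q} \<times> {c<..<d}"
  have s: "summable (\<lambda>n. X n x * Y n y)"
    by (rule summable_comparison_test'[OF M(1)]) (use M(2) z in auto)
  have "((\<lambda>t. \<Sum>n. X n x * Y n t) has_real_derivative (\<Sum>n. X n x * Y' n y)) (at y)"
    by (rule DERIV_suminf[where M = M and p = c and q = d]) (use Y M z s in \<open>auto intro!: derivative_eq_intros\<close>)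
  then show "((\<lambda>t. case (x, t) of (x, y) \<Rightarrow> \<Sum>n. X n x * Y n y) has_real_derivative
      (case (x, y) of (x, y) \<Rightarrow> \<Sum>n. X n x * Y' n y)) (at y)" by simp
qed

text \<open>A single summable majorant for the terms and all their derivatives up to order two
  justifies every termwise operation. Both the harmonic series and the particular solution of
  Poisson's equation are of this separated form.\<close>

lemma C2_laplacian_product_series:
  fixes X Y X' Y' X'' Y'' :: "nat \<Rightarrow> real \<Rightarrow> real"
  assumes X: "\<And>n x. x \<in> {p<..<q} \<Longrightarrow> (X n has_real_derivative X' n x) (at x)"
      "\<And>n x. x \<in> {p<..<q} \<Longrightarrow> (X' n has_real_derivative X'' n x) (at x)"
      "\<And>n. continuous_on {p<..<q} (X'' n)"
    and Y: "\<And>n y. y \<in> {c<..<d} \<Longrightarrow> (Y n has_real_derivative Y' n y) (at y)"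
      "\<And>n y. y \<in> {c<..<d} \<Longrightarrow> (Y' n has_real_derivative Y'' n y) (at y)"
      "\<And>n. continuous_on {c<..<d} (Y'' n)"
    and M: "summable M" "\<And>n x y. x \<in> {p<..<q} \<Longrightarrow> y \<in> {c<..<d} \<Longrightarrow>
      \<bar>X n x * Y n y\<bar> \<le> M n \<and> \<bar>X' n x * Y n y\<bar> \<le> M n \<and> \<bar>X n x * Y' n y\<bar> \<le> M n \<and>
      \<bar>X'' n x * Y n y\<bar> \<le> M n \<and> \<bar>X' n x * Y' n y\<bar> \<le> M n \<and> \<bar>X n x * Y'' n y\<bar> \<le> M n"
  shows "C2_laplacian ({p<..<q} \<times> {c<..<d}) (\<lambda>(x, y). \<Sum>n. X n x * Y n y)
    (\<lambda>(x, y). \<Sum>n. X'' n x * Y n y + X n x * Y'' n y)"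
proof -
  have cX: "continuous_on {p<..<q} (X' n)" for n
    by (rule DERIV_continuous_on) (use X in \<open>blast intro: DERIV_subset\<close>)
  have cX0: "continuous_on {p<..<q} (X n)" for n
    by (rule DERIV_continuous_on) (use X in \<open>blast intro: DERIV_subset\<close>)
  have cY0: "continuous_on {c<..<d} (Y n)" for n
    by (rule DERIV_continuous_on) (use Y in \<open>blast intro: DERIV_subset\<close>)
  have cY: "continuous_on {c<..<d} (Y' n)" for n
    by (rule DERIV_continuous_on) (use Y in \<open>blast intro: DERIV_subset\<close>)
  have eq: "(\<lambda>(x, y). \<Sum>n. X'' n x * Y n y) z + (\<lambda>(x, y). \<Sum>n. X n x * Y'' n y) z =
      (\<lambda>(x, y). \<Sum>n. X'' n x * Y n y + X n x * Y'' n y) z" if z: "z \<in> {p<..<q} \<times> {c<..<d}" for z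
  proof -
    obtain x y where xy: "z = (x, y)" by force
    have "summable (\<lambda>n. X'' n x * Y n y)" "summable (\<lambda>n. X n x * Y'' n y)"
      by (rule summable_comparison_test'[OF M(1)], use M(2)[of x y] z xy in auto)+
    then show ?thesis by (simp add: xy suminf_add)
  qed
  show ?thesis
    unfolding C2_laplacian_def
    by (rule exI[of _ "\<lambda>(x, y). \<Sum>n. X' n x * Y n y"], rule exI[of _ "\<lambda>(x, y). \<Sum>n. X n x * Y' n y"],
        rule exI[of _ "\<lambda>(x, y). \<Sum>n. X'' n x * Y n y"], rule exI[of _ "\<lambda>(x, y). \<Sum>n. X' n x * Y' n y"],
        rule exI[of _ "\<lambda>(x, y). \<Sum>n. X' n x * Y' n y"], rule exI[of _ "\<lambda>(x, y). \<Sum>n. X n x * Y'' n y"],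
        intro conjI has_partials_product_series continuous_on_product_series[where M=M] X Y M ballI eq cX cY cX0 cY0)
      (use M in auto)
qed

text \<open>Witnesses found on different neighbourhoods need not fit together, whereas
  \<open>pd1\<close> and \<open>pd2\<close> are globally defined; gluing therefore goes through
  \<open>Ck_open\<close>. This is meant for series whose second derivatives converge uniformly only
  away from one side.\<close>

lemma C2_laplacian_local:
  assumes S: "open S" and loc: "\<And>z. z \<in> S \<Longrightarrow> \<exists>T. open T \<and> z \<in> T \<and> C2_laplacian T u F"
  shows "C2_laplacian S u F"
proof -
  have C: "\<exists>T. open T \<and> z \<in> T \<and> Ck_open 2 T u \<and> (\<forall>w\<in>T. laplacian u w = F w)" if "z \<in> S" for z
    using loc[OF that] C2_laplacian_imp_Ck_open by metis
  have cont: "continuous_on S f" if "\<And>T. Ck_open 2 T u \<Longrightarrow> continuous_on T f" for f :: "real \<times> real \<Rightarrow> real"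
    unfolding continuous_on_eq_continuous_at[OF S]
  proof
    fix z assume "z \<in> S"
    then obtain T where "open T" "z \<in> T" "Ck_open 2 T u" using C by blast
    then show "isCont f z" using that continuous_on_eq_continuous_at by blast
  qed
  have pds: "has_pds_on S f" if "\<And>T. Ck_open 2 T u \<Longrightarrow> has_pds_on T f" for f
    unfolding has_pds_on_def
  proof
    fix z assume "z \<in> S"
    then obtain T where T: "open T" "z \<in> T" "Ck_open 2 T u" using C by blast
    from that[OF T(3)] T(2) show "case z of (x, y) \<Rightarrow> (\<lambda>t. f (t, y)) field_differentiable at x \<and>
      (\<lambda>t. f (x, t)) field_differentiable at y" unfolding has_pds_on_def by blast
  qed
  have "Ck_open 2 S u"
    by (auto simp: numeral_2_eq_2 intro!: cont pds)
  then show ?thesis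
    by (rule C2_laplacian_cong[OF S Ck_open_imp_C2_laplacian]) (use C in force)+
qed

section \<open>The maximum principle\<close>

text \<open>At the maximum the first derivative is zero. Were \<open>D\<close> positive, it would be
  positive just to the right, and by the mean value theorem \<open>f\<close> would increase
  there.\<close>

lemma local_max_second_deriv:
  fixes f :: "real \<Rightarrow> real"
  assumes d: "d > 0" and f: "\<And>t. \<bar>t - x\<bar> < d \<Longrightarrow> (f has_real_derivative f' t) (at t)"
    and f': "(f' has_real_derivative D) (at x)"
    and max: "\<And>t. \<bar>t - x\<bar> < d \<Longrightarrow> f t \<le> f x"
  shows "D \<le> 0"
proof (rule ccontr)
  assume "\<not> D \<le> 0"
  then obtain e where e: "e > 0" "\<And>h. 0 < h \<Longrightarrow> h < e \<Longrightarrow> f' x < f' (x + h)"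
    using DERIV_pos_inc_right[OF f'] by auto
  have 0: "f' x = 0"
    by (rule DERIV_local_max[OF f d]) (use d max in \<open>auto simp: abs_minus_commute\<close>)
  define h where "h = min d e / 2"
  have h: "0 < h" "h < d" "h < e" using d e by (auto simp: h_def min_def)
  obtain z where z: "x < z" "z < x + h" "f (x + h) - f x = (x + h - x) * f' z"
    using MVT2[of x "x + h" f f'] f h by auto
  have "f' z > 0" using e(2)[of "z - x"] z h 0 by auto
  then have "f (x + h) > f x" using z(3) h by (simp add: algebra_simps)
  then show False using max[of "x + h"] h by auto
qed

text \<open>Adding a small multiple of (x - p)^2 makes the Laplacian strictly positive, which is
  incompatible with an interior maximum, where both pure second derivatives are at most 0.\<close>

lemma max_principle:
  fixes u :: "real \<times> real \<Rightarrow> real"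
  assumes pq: "p < q"
    and cont: "continuous_on ({p..q} \<times> {c..d}) u"
    and C2: "C2_laplacian ({p<..<q} \<times> {c<..<d}) u (\<lambda>_. 0)"
    and bd: "\<And>x. x \<in> {p..q} \<Longrightarrow> u (x, c) \<le> M" "\<And>x. x \<in> {p..q} \<Longrightarrow> u (x, d) \<le> M"
      "\<And>y. y \<in> {c..d} \<Longrightarrow> u (p, y) \<le> M" "\<And>y. y \<in> {c..d} \<Longrightarrow> u (q, y) \<le> M"
    and z: "z \<in> {p..q} \<times> {c..d}"
  shows "u z \<le> M"
proof (rule ccontr)
  assume "\<not> u z \<le> M"
  then have uz: "u z > M" by simp
  \<comment> \<open>With this factor the added term is at most half of the excess
    \<open>u z - M\<close>, so that \<open>v\<close> cannot attain its maximum on the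
    boundary.\<close>
  define \<epsilon> where "\<epsilon> = (u z - M) / (2 * (q - p)\<^sup>2)"
  have \<epsilon>: "\<epsilon> > 0" "\<epsilon> * (q - p)\<^sup>2 = (u z - M) / 2" using uz pq by (auto simp: \<epsilon>_def)
  define v where "v w = u w + \<epsilon> * (fst w - p)\<^sup>2" for w
  have "continuous_on ({p..q} \<times> {c..d}) v"
    unfolding v_def[abs_def] by (intro continuous_intros cont)
  then obtain w where w: "w \<in> {p..q} \<times> {c..d}" "\<And>y. y \<in> {p..q} \<times> {c..d} \<Longrightarrow> v y \<le> v w"
    using continuous_attains_sup[of "{p..q} \<times> {c..d}" v] z compact_Times[OF compact_Icc compact_Icc] by blast
  obtain x y where xy: "w = (x, y)" by force
  have vz: "v w > M + \<epsilon> * (q - p)\<^sup>2"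
  proof -
    have "v w \<ge> v z" using w z by auto
    moreover have "v z \<ge> u z" using \<epsilon> by (simp add: v_def)
    ultimately show ?thesis using uz \<epsilon> by (auto simp: field_simps)
  qed
  have "\<epsilon> * (x - p)\<^sup>2 \<le> \<epsilon> * (q - p)\<^sup>2"
    using \<epsilon> w xy by (intro mult_left_mono power_mono) auto
  then have "u (x, y) > M" using vz by (auto simp: v_def xy)
  then have int: "(x, y) \<in> {p<..<q} \<times> {c<..<d}"
    using w(1) bd[of x] bd(3,4)[of y] unfolding xy
    by (cases "x = p"; cases "x = q"; cases "y = c"; cases "y = d") auto
  obtain ux uy uxx uxy uyx uyy where u:
    "has_partials ({p<..<q} \<times> {c<..<d}) u ux uy" "has_partials ({p<..<q} \<times> {c<..<d}) ux uxx uxy"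
    "has_partials ({p<..<q} \<times> {c<..<d}) uy uyx uyy"
    "\<And>z. z \<in> {p<..<q} \<times> {c<..<d} \<Longrightarrow> uxx z + uyy z = 0" using C2 unfolding C2_laplacian_def by auto
  note H = u(1-3)[unfolded has_partials_def]
  have "uxx (x, y) + 2 * \<epsilon> \<le> 0"
  proof (rule local_max_second_deriv)
    show "min (x - p) (q - x) > 0" using int by auto
    show "((\<lambda>t. v (t, y)) has_real_derivative ux (t, y) + 2 * \<epsilon> * (t - p)) (at t)"
      if "\<bar>t - x\<bar> < min (x - p) (q - x)" for t
    proof -
      have "((\<lambda>t. u (t, y)) has_real_derivative ux (t, y)) (at t)"
        using H int that by (auto simp: abs_if split: if_splits)
      then show ?thesis unfolding v_def by (auto intro!: derivative_eq_intros)
    qed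
    show "((\<lambda>t. ux (t, y) + 2 * \<epsilon> * (t - p)) has_real_derivative uxx (x, y) + 2 * \<epsilon>) (at x)"
      using H int by (auto intro!: derivative_eq_intros)
    show "v (t, y) \<le> v (x, y)" if "\<bar>t - x\<bar> < min (x - p) (q - x)" for t
      using w(2)[of "(t, y)"] that int unfolding xy by (auto simp: abs_if split: if_splits)
  qed
  moreover have "uyy (x, y) \<le> 0"
  proof (rule local_max_second_deriv)
    show "min (y - c) (d - y) > 0" using int by auto
    show "((\<lambda>t. v (x, t)) has_real_derivative uy (x, t)) (at t)"
      if "\<bar>t - y\<bar> < min (y - c) (d - y)" for t
    proof -
      have "((\<lambda>t. u (x, t)) has_real_derivative uy (x, t)) (at t)"
        using H int that by (auto simp: abs_if split: if_splits)
      then show ?thesis unfolding v_def by (auto intro!: derivative_eq_intros)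
    qed
    show "((\<lambda>t. uy (x, t)) has_real_derivative uyy (x, y)) (at y)"
      using H int by auto
    show "v (x, t) \<le> v (x, y)" if "\<bar>t - y\<bar> < min (y - c) (d - y)" for t
      using w(2)[of "(x, t)"] that int unfolding xy by (auto simp: abs_if split: if_splits)
  qed
  ultimately show False using u(4)[OF int] \<epsilon> by auto
qed

lemma max_principle_abs:
  fixes u :: "real \<times> real \<Rightarrow> real"
  assumes pq: "p < q"
    and cont: "continuous_on ({p..q} \<times> {c..d}) u"
    and C2: "C2_laplacian ({p<..<q} \<times> {c<..<d}) u (\<lambda>_. 0)"
    and bd: "\<And>x. x \<in> {p..q} \<Longrightarrow> \<bar>u (x, c)\<bar> \<le> M" "\<And>x. x \<in> {p..q} \<Longrightarrow> \<bar>u (x, d)\<bar> \<le> M"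
      "\<And>y. y \<in> {c..d} \<Longrightarrow> \<bar>u (p, y)\<bar> \<le> M" "\<And>y. y \<in> {c..d} \<Longrightarrow> \<bar>u (q, y)\<bar> \<le> M"
    and z: "z \<in> {p..q} \<times> {c..d}"
  shows "\<bar>u z\<bar> \<le> M"
proof -
  have "u z \<le> M" using max_principle[OF pq cont C2 _ _ _ _ z] bd by (simp add: abs_le_iff)
  moreover have "- u z \<le> M"
    using max_principle[OF pq continuous_on_minus[OF cont], of M z]
      C2_laplacian_lin[OF C2 C2, of "-1" 0] bd z by (simp add: abs_le_iff)
  ultimately show ?thesis by (simp add: abs_le_iff)
qed

section \<open>Harmonic functions with one inhomogeneous side\<close>

text \<open>From exp t \<ge> (1 + t / 4)^4 the exponential beats a fourth power of the frequency.
  Two powers pay for two derivatives, the other two leave a summable inverse square.\<close>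

lemma summable_nu_exp:
  assumes b: "b > 0" and \<delta>: "\<delta> > 0"
  shows "summable (\<lambda>n. C * (1 + nu b n)\<^sup>2 * exp (- (nu b n * \<delta>)))"
proof -
  \<comment> \<open>Chosen so that \<kappa> (1 + N) \<le> 1 + N \<delta> / 4 for every positive
    N.\<close>
  define \<kappa> where "\<kappa> = min 1 (\<delta> / 4)"
  have \<kappa>: "0 < \<kappa>" "\<kappa> \<le> 1" "\<kappa> \<le> \<delta> / 4" using \<delta> by (auto simp: \<kappa>_def)
  show ?thesis
  proof (rule summable_comparison_test'[OF summable_inverse_nu_sq[OF b, of "\<bar>C\<bar> / \<kappa> ^ 4"]])
    fix n
    define N where "N = nu b n"
    have N: "N > 0" using b nu_pos by (simp add: N_def)
    have "\<kappa> * (1 + N) \<le> 1 + N * \<delta> / 4"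
    proof -
      have "\<kappa> * N \<le> \<delta> / 4 * N" using \<kappa> N by (intro mult_right_mono) auto
      then show ?thesis using \<kappa> by (simp add: algebra_simps)
    qed
    then have "(\<kappa> * (1 + N)) ^ 4 \<le> (1 + N * \<delta> / 4) ^ 4" using \<kappa> N by (intro power_mono) auto
    also have "\<dots> \<le> exp (N * \<delta>)" using exp_ge_one_plus_x_over_n_power_n[of 4 "N * \<delta>"] N \<delta>
      by (simp add: order.trans[OF _ mult_nonneg_nonneg])
    finally have 1: "\<kappa> ^ 4 * (1 + N) ^ 4 \<le> exp (N * \<delta>)" by (simp add: power_mult_distrib)
    have "(1 + N)\<^sup>2 * exp (- (N * \<delta>)) * (\<kappa> ^ 4 * N\<^sup>2) \<le> (1 + N)\<^sup>2 * exp (- (N * \<delta>)) * (\<kappa> ^ 4 * (1 + N)\<^sup>2)"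
      using \<kappa> N by (intro mult_left_mono power_mono) auto
    also have "\<dots> = exp (- (N * \<delta>)) * (\<kappa> ^ 4 * (1 + N) ^ 4)"
      by (simp add: power2_eq_square power4_eq_xxxx mult_ac)
    also have "\<dots> \<le> exp (- (N * \<delta>)) * exp (N * \<delta>)" using 1 by (intro mult_left_mono) auto
    also have "\<dots> = 1" by (simp flip: exp_add)
    finally have 2: "(1 + N)\<^sup>2 * exp (- (N * \<delta>)) \<le> 1 / (\<kappa> ^ 4 * N\<^sup>2)"
      using \<kappa> N by (simp add: pos_le_divide_eq)
    have "\<bar>C\<bar> * ((1 + N)\<^sup>2 * exp (- (N * \<delta>))) \<le> \<bar>C\<bar> * (1 / (\<kappa> ^ 4 * N\<^sup>2))"
      using 2 by (intro mult_left_mono) auto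
    then show "norm (C * (1 + nu b n)\<^sup>2 * exp (- (nu b n * \<delta>))) \<le> \<bar>C\<bar> / \<kappa> ^ 4 / (nu b n)\<^sup>2"
      by (simp add: N_def abs_mult mult.assoc)
  qed
qed

lemma sinh_ratio_bounds:
  fixes N a x :: real
  assumes N: "N > 0" and x: "0 \<le> x" "x \<le> a" and a: "0 < a"
  shows "0 \<le> sinh (N * x) / sinh (N * a)" "sinh (N * x) / sinh (N * a) \<le> exp (- (N * (a - x)))"
proof -
  have s: "sinh (N * a) > 0" using N a by simp
  show "0 \<le> sinh (N * x) / sinh (N * a)" using s N x by simp
  have "exp (N * x - 2 * (N * a)) \<le> exp (- (N * x))"
    using N x mult_left_mono[OF x(2), of N] by simp
  moreover have "exp (- (N * (a - x))) * sinh (N * a) = (exp (N * x) - exp (N * x - 2 * (N * a))) / 2"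
    by (simp add: sinh_field_def right_diff_distrib diff_divide_distrib flip: exp_add)
  ultimately have "sinh (N * x) \<le> exp (- (N * (a - x))) * sinh (N * a)"
    by (simp add: sinh_field_def)
  then show "sinh (N * x) / sinh (N * a) \<le> exp (- (N * (a - x)))" using s by (simp add: pos_divide_le_eq)
qed

text \<open>The denominator sinh (N a) is exp (N a) up to the factor (1 - exp (- 2 N a)) / 2, which
  is smallest at the lowest frequency. Hence \<open>N0\<close> yields one constant for all
  modes.\<close>

lemma cosh_ratio_bound:
  fixes N N0 a x :: real
  assumes N: "0 < N0" "N0 \<le> N" and x: "0 \<le> x" and a: "0 < a"
  shows "cosh (N * x) / sinh (N * a) \<le> 2 / (1 - exp (- (2 * (N0 * a)))) * exp (- (N * (a - x)))"
proof -
  define K where "K = 2 / (1 - exp (- (2 * (N0 * a))))"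
  have e: "exp (- (2 * (N0 * a))) < 1" using N a by simp
  have K: "K > 0" using e by (simp add: K_def)
  have s: "sinh (N * a) > 0" using N a by simp
  have "- (2 * (N * a)) \<le> - (2 * (N0 * a))" using N a by simp
  then have "exp (- (2 * (N * a))) \<le> exp (- (2 * (N0 * a)))" by simp
  then have "1 \<le> K * ((1 - exp (- (2 * (N * a)))) / 2)" using e by (simp add: K_def pos_le_divide_eq)
  then have "exp (N * x) * 1 \<le> exp (N * x) * (K * ((1 - exp (- (2 * (N * a)))) / 2))"
    by (intro mult_left_mono) auto
  also have "\<dots> = K * exp (- (N * (a - x))) * sinh (N * a)"
    by (simp add: sinh_field_def algebra_simps flip: exp_add)
  finally have "exp (N * x) \<le> K * exp (- (N * (a - x))) * sinh (N * a)" by simp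
  moreover have "cosh (N * x) \<le> exp (N * x)" using N x by (simp add: cosh_field_def)
  ultimately have "cosh (N * x) \<le> K * exp (- (N * (a - x))) * sinh (N * a)" by linarith
  then show ?thesis using s by (simp add: pos_divide_le_eq K_def)
qed

definition side_series :: "real \<Rightarrow> real \<Rightarrow> (nat \<Rightarrow> real) \<Rightarrow> real \<times> real \<Rightarrow> real"
  where "side_series a b c = (\<lambda>(x, y). \<Sum>n. c n * (sinh (nu b n * x) / sinh (nu b n * a)) * sin (nu b n * y))"

lemma nu_mono: "b > 0 \<Longrightarrow> nu b 0 \<le> nu b n"
  by (simp add: nu_def divide_right_mono)

text \<open>Bounded coefficients suffice because for x < q < a the hyperbolic ratios decay like exp
  (- N (a - q)), which absorbs two derivatives. There is no such decay at x = a, hence the local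
  argument with \<open>q\<close> between the given point and the side.\<close>

lemma C2_laplacian_side_series:
  assumes a: "a > 0" and b: "b > 0" and C: "\<And>n. \<bar>c n\<bar> \<le> C"
  shows "C2_laplacian ({0<..<a} \<times> {0<..<b}) (side_series a b c) (\<lambda>_. 0)"
proof (rule C2_laplacian_local)
  show "open ({0<..<a} \<times> {0<..<b})" by (intro open_Times) auto
  fix z assume z: "z \<in> {0<..<a} \<times> {0<..<b}"
  define q where "q = (fst z + a) / 2"
  have q: "0 < q" "q < a" "z \<in> {0<..<q} \<times> {0<..<b}" using z by (auto simp: q_def)
  define K where "K = 2 / (1 - exp (- (2 * (nu b 0 * a))))"
  have K: "K \<ge> 0" using a b nu_pos[of b 0] by (simp add: K_def)
  have C0: "0 \<le> C" using C[of 0] by linarith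
  define M where "M n = C * K * (1 + nu b n)\<^sup>2 * exp (- (nu b n * (a - q)))" for n
  define X where "X n x = c n * (sinh (nu b n * x) / sinh (nu b n * a))" for n x
  define X' where "X' n x = c n * (nu b n * (cosh (nu b n * x) / sinh (nu b n * a)))" for n x
  define X'' where "X'' n x = c n * (nu b n ^ 2 * (sinh (nu b n * x) / sinh (nu b n * a)))" for n x
  have sp: "sinh (nu b n * a) > 0" for n using nu_pos[OF b, of n] a by simp
  \<comment> \<open>One estimate for all derivatives: \<open>i\<close> differentiations in x and
    \<open>j\<close> in y produce the powers of the frequency, and \<open>r\<close> is the ratio
    with sinh or with cosh, both at most the latter.\<close>
  have R: "\<bar>c n * (nu b n ^ i * r) * t\<bar> \<le> M n"
    if r: "0 \<le> r" "r \<le> cosh (nu b n * x) / sinh (nu b n * a)" and x: "0 < x" "x < q"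
      and t: "\<bar>t\<bar> \<le> nu b n ^ j" and ij: "i + j \<le> 2" for n i j r x t
  proof -
    let ?N = "nu b n"
    have N: "?N > 0" using nu_pos[OF b] .
    have "r \<le> K * exp (- (?N * (a - x)))"
      using r(2) cosh_ratio_bound[OF nu_pos[OF b, of 0] nu_mono[OF b, of n], of x a] x a
      by (simp add: K_def)
    also have "\<dots> \<le> K * exp (- (?N * (a - q)))"
      using K N x by (intro mult_left_mono) auto
    finally have r': "r \<le> K * exp (- (?N * (a - q)))" .
    have "?N ^ i * \<bar>t\<bar> \<le> ?N ^ i * ?N ^ j" using t N by (intro mult_left_mono) auto
    also have "\<dots> = ?N ^ (i + j)" by (simp add: power_add)
    also have "\<dots> \<le> (1 + ?N) ^ (i + j)" using N by (intro power_mono) auto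
    also have "\<dots> \<le> (1 + ?N) ^ 2" using N ij by (intro power_increasing) auto
    finally have Nt: "?N ^ i * \<bar>t\<bar> \<le> (1 + ?N) ^ 2" .
    have "\<bar>c n * (?N ^ i * r) * t\<bar> = \<bar>c n\<bar> * (r * (?N ^ i * \<bar>t\<bar>))"
      using N r by (simp add: abs_mult)
    also have "\<dots> \<le> C * (K * exp (- (?N * (a - q))) * (1 + ?N)\<^sup>2)"
      using C[of n] r r' Nt N C0 K by (intro mult_mono mult_nonneg_nonneg) auto
    finally show ?thesis by (simp add: M_def mult_ac)
  qed
  have sc: "0 \<le> sinh (nu b n * x) / sinh (nu b n * a)"
    "sinh (nu b n * x) / sinh (nu b n * a) \<le> cosh (nu b n * x) / sinh (nu b n * a)"
    "0 \<le> cosh (nu b n * x) / sinh (nu b n * a)" if "0 < x" for n x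
    using sp[of n] nu_pos[OF b, of n] that by (auto simp: divide_right_mono sinh_le_cosh_real)
  have "C2_laplacian ({0<..<q} \<times> {0<..<b}) (\<lambda>(x, y). \<Sum>n. X n x * sin (nu b n * y))
    (\<lambda>(x, y). \<Sum>n. X'' n x * sin (nu b n * y) + X n x * (- (nu b n ^ 2 * sin (nu b n * y))))"
  proof (rule C2_laplacian_product_series[where X' = X' and M = M and Y' = "\<lambda>n y. nu b n * cos (nu b n * y)"])
    show "summable M" unfolding M_def[abs_def] using q by (intro summable_nu_exp b) auto
    fix n
    show "(X n has_real_derivative X' n x) (at x)" for x
      unfolding X_def[abs_def] X'_def using sp[of n] by (auto intro!: derivative_eq_intros)
    show "(X' n has_real_derivative X'' n x) (at x)" for x
      unfolding X''_def X'_def[abs_def] using sp[of n] by (auto intro!: derivative_eq_intros simp: power2_eq_square)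
    show "continuous_on {0<..<q} (X'' n)"
      unfolding X''_def[abs_def] using sp[of n] by (intro continuous_intros) auto
    show "((\<lambda>y. sin (nu b n * y)) has_real_derivative nu b n * cos (nu b n * y)) (at y)" for y
      by (auto intro!: derivative_eq_intros)
    show "((\<lambda>y. nu b n * cos (nu b n * y)) has_real_derivative - (nu b n ^ 2 * sin (nu b n * y))) (at y)" for y
      by (auto intro!: derivative_eq_intros simp: power2_eq_square)
    show "continuous_on {0<..<b} (\<lambda>y. - (nu b n ^ 2 * sin (nu b n * y)))"
      by (intro continuous_intros)
    fix x y assume x: "x \<in> {0<..<q}" and y: "y \<in> {0<..<b}"
    have N: "nu b n > 0" using nu_pos[OF b] .
    have t: "\<bar>sin (nu b n * y)\<bar> \<le> nu b n ^ 0" "\<bar>nu b n * cos (nu b n * y)\<bar> \<le> nu b n ^ 1"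
      "\<bar>- (nu b n ^ 2 * sin (nu b n * y))\<bar> \<le> nu b n ^ 2"
      using N by (auto simp: abs_mult mult_left_le)
    have x': "0 < x" "x < q" using x by auto
    show "\<bar>X n x * sin (nu b n * y)\<bar> \<le> M n \<and> \<bar>X' n x * sin (nu b n * y)\<bar> \<le> M n \<and>
       \<bar>X n x * (nu b n * cos (nu b n * y))\<bar> \<le> M n \<and> \<bar>X'' n x * sin (nu b n * y)\<bar> \<le> M n \<and>
       \<bar>X' n x * (nu b n * cos (nu b n * y))\<bar> \<le> M n \<and> \<bar>X n x * (- (nu b n ^ 2 * sin (nu b n * y)))\<bar> \<le> M n"
      using R[OF sc(1,2)[OF x'(1)] x' t(1), of 0] R[OF sc(3)[OF x'(1)] order.refl x' t(1), of 1]
        R[OF sc(1,2)[OF x'(1)] x' t(2), of 0] R[OF sc(1,2)[OF x'(1)] x' t(1), of 2]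
        R[OF sc(3)[OF x'(1)] order.refl x' t(2), of 1] R[OF sc(1,2)[OF x'(1)] x' t(3), of 0]
      by (simp add: X_def X'_def X''_def)
  qed
  then have "C2_laplacian ({0<..<q} \<times> {0<..<b}) (side_series a b c) (\<lambda>_. 0)"
    by (rule C2_laplacian_cong[rotated]) (auto intro!: open_Times simp: side_series_def X_def X''_def algebra_simps)
  then show "\<exists>T. open T \<and> z \<in> T \<and> C2_laplacian T (side_series a b c) (\<lambda>_. 0)"
    using q by (intro exI[of _ "{0<..<q} \<times> {0<..<b}"]) (auto intro!: open_Times)
qed

lemma side_series_boundary:
  assumes "a > 0" "b > 0"
  shows "side_series a b c (0, y) = 0" "side_series a b c (x, 0) = 0" "side_series a b c (x, b) = 0"
    "side_series a b c (a, y) = sine_sum b c y"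
  using assms nu_pos[of b] by (auto simp: side_series_def sine_sum_def less_imp_neq[OF nu_pos, symmetric])

lemma abs_sinh_ratio_le:
  assumes "a > 0" "b > 0" "0 \<le> x" "x \<le> a"
  shows "\<bar>sinh (nu b n * x) / sinh (nu b n * a)\<bar> \<le> exp (- (nu b n * (a - x)))"
    "\<bar>sinh (nu b n * x) / sinh (nu b n * a)\<bar> \<le> 1"
proof -
  have "exp (- (nu b n * (a - x))) \<le> 1" using nu_pos[of b n] assms by simp
  moreover note B = sinh_ratio_bounds[OF nu_pos[OF assms(2), of n] assms(3,4,1)]
  ultimately show "\<bar>sinh (nu b n * x) / sinh (nu b n * a)\<bar> \<le> exp (- (nu b n * (a - x)))"
    "\<bar>sinh (nu b n * x) / sinh (nu b n * a)\<bar> \<le> 1"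
    unfolding abs_of_nonneg[OF B(1)] by linarith+
qed

lemma continuous_on_side_series:
  assumes "a > 0" "b > 0" and c: "summable (\<lambda>n. \<bar>c n\<bar>)"
  shows "continuous_on ({0..a} \<times> {0..b}) (side_series a b c)"
  unfolding side_series_def
proof (rule continuous_on_product_series[OF _ _ _ c])
  fix n
  have "sinh (nu b n * a) \<noteq> 0" using nu_pos[of b n] assms by auto
  then show "continuous_on {0..a} (\<lambda>x. c n * (sinh (nu b n * x) / sinh (nu b n * a)))"
    by (intro continuous_intros) auto
  show "continuous_on {0..b} (\<lambda>y. sin (nu b n * y))" by (intro continuous_intros)
  fix x y assume "x \<in> {0..a}" "y \<in> {0..b}"
  then have "\<bar>c n\<bar> * (\<bar>sinh (nu b n * x) / sinh (nu b n * a)\<bar> * \<bar>sin (nu b n * y)\<bar>) \<le> \<bar>c n\<bar> * (1 * 1)"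
    using abs_sinh_ratio_le(2)[of a b x n] assms by (intro mult_left_mono mult_mono) auto
  then show "\<bar>c n * (sinh (nu b n * x) / sinh (nu b n * a)) * sin (nu b n * y)\<bar> \<le> \<bar>c n\<bar>"
    by (simp add: abs_mult mult_ac)
qed

text \<open>Smoothing inside the rectangle: at positive distance from x = a the factors decay
  exponentially, so that bounded coefficients turn into absolutely summable ones. This makes the
  traces at \<open>xm\<close> and \<open>xp\<close> good even when the trace at \<open>x0\<close> is
  merely continuous.\<close>

lemma summable_side_series:
  assumes "a > 0" "b > 0" "\<And>n. \<bar>c n\<bar> \<le> C" "0 \<le> x" "x < a"
  shows "summable (\<lambda>n. \<bar>c n * (sinh (nu b n * x) / sinh (nu b n * a))\<bar>)"
proof (rule summable_comparison_test'[OF summable_nu_exp[OF \<open>b > 0\<close>, of "a - x" C]])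
  fix n
  have "1 \<le> (1 + nu b n)\<^sup>2" using nu_pos[of b n] assms by simp
  then have "C * 1 * exp (- (nu b n * (a - x))) \<le> C * (1 + nu b n)\<^sup>2 * exp (- (nu b n * (a - x)))"
    using order.trans[OF abs_ge_zero assms(3)[of n]] by (intro mult_mono) auto
  moreover have "\<bar>c n\<bar> * \<bar>sinh (nu b n * x) / sinh (nu b n * a)\<bar> \<le> C * exp (- (nu b n * (a - x)))"
    using abs_sinh_ratio_le(1)[of a b x n] assms order.trans[OF abs_ge_zero assms(3)[of n]] by (intro mult_mono) auto
  ultimately show "norm \<bar>c n * (sinh (nu b n * x) / sinh (nu b n * a))\<bar> \<le>
      C * (1 + nu b n)\<^sup>2 * exp (- (nu b n * (a - x)))" by (simp add: abs_mult)
qed (use assms in auto)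

lemma side_series_diff:
  assumes "a > 0" "b > 0" "\<And>n. \<bar>c n\<bar> \<le> C" "\<And>n. \<bar>d n\<bar> \<le> D" "0 \<le> x" "x < a"
  shows "side_series a b c (x, y) - side_series a b d (x, y) = side_series a b (\<lambda>n. c n - d n) (x, y)"
proof -
  note s = summable_sine_terms[OF summable_side_series[OF assms(1,2) _ assms(5,6)]]
  show ?thesis
    using suminf_diff[OF s[of c C b y, OF assms(3)] s[of d D b y, OF assms(4)]]
    by (simp add: side_series_def left_diff_distrib diff_divide_distrib)
qed

text \<open>The bound is linear in the size of the coefficients, with a factor depending only on
  \<open>x\<close>. Coefficients that converge uniformly in n therefore give series that converge at
  every point with x < a.\<close>

lemma side_series_le:
  assumes "a > 0" "b > 0" "\<And>n. \<bar>c n\<bar> \<le> C" "0 \<le> x" "x < a"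
  shows "\<bar>side_series a b c (x, y)\<bar> \<le> C * (\<Sum>n. exp (- (nu b n * (a - x))))"
proof -
  have C: "0 \<le> C" using assms(3)[of 0] by linarith
  have e: "summable (\<lambda>n. exp (- (nu b n * (a - x))))"
  proof (rule summable_comparison_test'[OF summable_nu_exp[of b "a - x" 1]])
    fix n
    have "1 \<le> (1 + nu b n)\<^sup>2" using nu_pos[of b n] assms by simp
    then show "norm (exp (- (nu b n * (a - x)))) \<le> 1 * (1 + nu b n)\<^sup>2 * exp (- (nu b n * (a - x)))"
      by (simp add: mult_le_cancel_right1)
  qed (use assms in auto)
  have le: "\<bar>c n * (sinh (nu b n * x) / sinh (nu b n * a)) * sin (nu b n * y)\<bar> \<le> C * exp (- (nu b n * (a - x)))" for n
  proof -
    have "\<bar>c n\<bar> * (\<bar>sinh (nu b n * x) / sinh (nu b n * a)\<bar> * \<bar>sin (nu b n * y)\<bar>) \<le> C * (exp (- (nu b n * (a - x))) * 1)"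
      using abs_sinh_ratio_le(1)[of a b x n] assms C by (intro mult_mono) auto
    then show ?thesis by (simp add: abs_mult mult_ac)
  qed
  have s: "summable (\<lambda>n. \<bar>c n * (sinh (nu b n * x) / sinh (nu b n * a)) * sin (nu b n * y)\<bar>)"
    by (rule summable_comparison_test'[OF summable_mult[OF e, of C]]) (use le in auto)
  have "\<bar>side_series a b c (x, y)\<bar> \<le> (\<Sum>n. \<bar>c n * (sinh (nu b n * x) / sinh (nu b n * a)) * sin (nu b n * y)\<bar>)"
    unfolding side_series_def using summable_rabs[OF s] by simp
  also have "\<dots> \<le> (\<Sum>n. C * exp (- (nu b n * (a - x))))"
    by (rule suminf_le[OF le s summable_mult[OF e]])
  also have "\<dots> = C * (\<Sum>n. exp (- (nu b n * (a - x))))" by (rule suminf_mult[OF e])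
  finally show ?thesis .
qed

text \<open>The function with boundary values \<open>g\<close> on the side \<open>x = a\<close>. Its sine series need not
  converge at \<open>x = a\<close> itself.\<close>

definition side_ext :: "real \<Rightarrow> real \<Rightarrow> (real \<Rightarrow> real) \<Rightarrow> real \<times> real \<Rightarrow> real"
  where "side_ext a b g z = (if fst z = a then g (snd z) else side_series a b (sine_coeff b g) z)"

lemma sine_coeff_diff:
  assumes "continuous_on {0..b} f" "continuous_on {0..b} g"
  shows "sine_coeff b (\<lambda>y. f y - g y) n = sine_coeff b f n - sine_coeff b g n"
proof -
  have "integral {0..b} (\<lambda>y. f y * sin (nu b n * y) - g y * sin (nu b n * y)) =
      integral {0..b} (\<lambda>y. f y * sin (nu b n * y)) - integral {0..b} (\<lambda>y. g y * sin (nu b n * y))"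
    by (intro integral_diff integrable_continuous_real continuous_intros assms)
  then show ?thesis by (simp add: sine_coeff_def left_diff_distrib right_diff_distrib)
qed

lemma bounded_sine_coeff:
  assumes "b > 0" "continuous_on {0..b} g"
  obtains C where "\<And>n. \<bar>sine_coeff b g n\<bar> \<le> C"
proof -
  obtain B where "\<And>y. y \<in> {0..b} \<Longrightarrow> \<bar>g y\<bar> \<le> B"
    using compact_imp_bounded[OF compact_continuous_image[OF assms(2) compact_Icc]]
    unfolding bounded_pos by (auto simp del: atLeastAtMost_iff)
  then show ?thesis using that sine_coeff_bound[OF assms] by blast
qed

text \<open>Inside, the coefficients of \<open>g\<close> are bounded, which suffices. Continuity up
  to x = a is the difficulty: \<open>g\<close> is approximated by sine sums \<open>e j\<close>,
  whose extensions \<open>w j\<close> are continuous on the closed rectangle and converge uniformly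
  to \<open>side_ext a b g\<close>.\<close>

lemma side_ext_harmonic:
  assumes a: "a > 0" and b: "b > 0" and g: "continuous_on {0..b} g" and ends: "g 0 = 0" "g b = 0"
  shows "continuous_on ({0..a} \<times> {0..b}) (side_ext a b g)"
    and "C2_laplacian ({0<..<a} \<times> {0<..<b}) (side_ext a b g) (\<lambda>_. 0)"
proof -
  obtain C where C: "\<And>n. \<bar>sine_coeff b g n\<bar> \<le> C" using bounded_sine_coeff[OF b g] by auto
  show "C2_laplacian ({0<..<a} \<times> {0<..<b}) (side_ext a b g) (\<lambda>_. 0)"
    by (rule C2_laplacian_cong[OF _ C2_laplacian_side_series[OF a b C]])
      (auto simp: side_ext_def intro!: open_Times)
  have "\<exists>e. summable (\<lambda>n. \<bar>e n\<bar>) \<and> (\<forall>y\<in>{0..b}. \<bar>g y - sine_sum b e y\<bar> \<le> 1 / real (Suc j))" for j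
    using sine_sum_dense[OF b g ends, of "1 / real (Suc j)"] by (metis of_nat_0_less_iff zero_less_Suc zero_less_divide_1_iff)
  then obtain e where e: "\<And>j. summable (\<lambda>n. \<bar>e j n\<bar>)"
    "\<And>j y. y \<in> {0..b} \<Longrightarrow> \<bar>g y - sine_sum b (e j) y\<bar> \<le> 1 / real (Suc j)" by metis
  have cf: "e j = sine_coeff b (sine_sum b (e j))" for j
    using sine_coeff_sine_sum[OF b e(1)] by auto
  \<comment> \<open>A uniform approximation of \<open>g\<close> also approximates all its
    coefficients, uniformly in n.\<close>
  have diff: "\<bar>e j n - sine_coeff b g n\<bar> \<le> 2 * (1 / real (Suc j))" for j n
    by (subst cf, subst sine_coeff_diff[symmetric, OF continuous_on_sine_sum[OF e(1)] g],
        rule sine_coeff_bound[OF b]) (use e(2)[of _ j] in \<open>auto simp: abs_minus_commute intro!: continuous_intros continuous_on_sine_sum e g\<close>)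
  have eb: "\<bar>e j n\<bar> \<le> C + 2" for j n
  proof -
    have "\<bar>e j n - sine_coeff b g n\<bar> \<le> 2"
      by (rule order.trans[OF diff]) (simp add: divide_le_eq)
    then show ?thesis using C[of n] by linarith
  qed
  define w where "w j = side_series a b (e j)" for j
  have wc: "continuous_on ({0..a} \<times> {0..b}) (w j)" for j
    unfolding w_def by (rule continuous_on_side_series[OF a b e(1)])
  \<comment> \<open>The difference is harmonic and vanishes on three sides; on x = a both functions
    are close to \<open>g\<close>. So the sequence is uniformly Cauchy.\<close>
  have ww: "\<bar>w j z - w i z\<bar> \<le> 1 / real (Suc j) + 1 / real (Suc i)" if z: "z \<in> {0..a} \<times> {0..b}" for i j z
  proof (rule max_principle_abs[OF a _ _ _ _ _ _ z])
    show "continuous_on ({0..a} \<times> {0..b}) (\<lambda>z. w j z - w i z)" by (intro continuous_intros wc)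
    show "C2_laplacian ({0<..<a} \<times> {0<..<b}) (\<lambda>z. w j z - w i z) (\<lambda>_. 0)"
      using C2_laplacian_diff[OF C2_laplacian_side_series[OF a b eb[of j]] C2_laplacian_side_series[OF a b eb[of i]]]
      by (simp add: w_def)
    show "\<bar>w j (a, y) - w i (a, y)\<bar> \<le> 1 / real (Suc j) + 1 / real (Suc i)" if "y \<in> {0..b}" for y
      using e(2)[OF that, of i] e(2)[OF that, of j] by (simp add: w_def side_series_boundary[OF a b])
  qed (auto simp: w_def side_series_boundary[OF a b])
  \<comment> \<open>The limit is identified pointwise: on x = a by the choice of \<open>e\<close>,
    elsewhere by comparing coefficients.\<close>
  have lim: "(\<lambda>i. w i z) \<longlonglongrightarrow> side_ext a b g z" if z: "z \<in> {0..a} \<times> {0..b}" for z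
  proof -
    obtain x y where xy: "z = (x, y)" "0 \<le> x" "x \<le> a" "y \<in> {0..b}" using z by auto
    show ?thesis
    proof (cases "x = a")
      case True
      have "(\<lambda>i. w i z - side_ext a b g z) \<longlonglongrightarrow> 0"
      proof (rule Lim_null_comparison[OF always_eventually])
        show "\<forall>i. norm (w i z - side_ext a b g z) \<le> 1 / real (Suc i)"
          using True xy e(2)[OF xy(4)] by (simp add: w_def side_series_boundary[OF a b] side_ext_def abs_minus_commute)
        show "(\<lambda>i. 1 / real (Suc i)) \<longlonglongrightarrow> 0" using lim_1_over_n LIMSEQ_Suc by fastforce
      qed
      then show ?thesis by (simp add: LIM_zero_iff)
    next
      case False
      then have x: "0 \<le> x" "x < a" using xy by auto
      let ?S = "\<Sum>n. exp (- (nu b n * (a - x)))"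
      have "(\<lambda>i. w i z - side_ext a b g z) \<longlonglongrightarrow> 0"
      proof (rule Lim_null_comparison[OF always_eventually])
        show "\<forall>i. norm (w i z - side_ext a b g z) \<le> 2 * (1 / real (Suc i)) * ?S"
        proof
          fix i
          have "w i z - side_ext a b g z = side_series a b (\<lambda>n. e i n - sine_coeff b g n) (x, y)"
            using False side_series_diff[OF a b eb[of i] C x, where y = y] by (simp add: w_def side_ext_def xy)
          also have "\<bar>\<dots>\<bar> \<le> 2 * (1 / real (Suc i)) * ?S"
            by (rule side_series_le[OF a b diff x])
          finally show "norm (w i z - side_ext a b g z) \<le> 2 * (1 / real (Suc i)) * ?S" by simp
        qed
        have "(\<lambda>i. 2 * (1 / real (Suc i)) * ?S) \<longlonglongrightarrow> 2 * 0 * ?S"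
          by (intro tendsto_intros LIMSEQ_Suc lim_1_over_n)
        then show "(\<lambda>i. 2 * (1 / real (Suc i)) * ?S) \<longlonglongrightarrow> 0" by simp
      qed
      then show ?thesis by (simp add: LIM_zero_iff)
    qed
  qed
  \<comment> \<open>Letting i tend to infinity in \<open>ww\<close> turns pointwise convergence into
    a uniform rate.\<close>
  have close: "\<bar>w j z - side_ext a b g z\<bar> \<le> 1 / real (Suc j)" if z: "z \<in> {0..a} \<times> {0..b}" for j z
  proof (rule tendsto_le[OF trivial_limit_sequentially])
    show "(\<lambda>i. 1 / real (Suc j) + 1 / real (Suc i)) \<longlonglongrightarrow> 1 / real (Suc j)"
      using tendsto_add[OF tendsto_const LIMSEQ_Suc[OF lim_1_over_n], of "1 / real (Suc j)"] by simp
    show "(\<lambda>i. \<bar>w j z - w i z\<bar>) \<longlonglongrightarrow> \<bar>w j z - side_ext a b g z\<bar>"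
      by (intro tendsto_intros lim[OF z])
    show "\<forall>\<^sub>F i in sequentially. \<bar>w j z - w i z\<bar> \<le> 1 / real (Suc j) + 1 / real (Suc i)"
      using ww[OF z] by simp
  qed
  have "uniform_limit ({0..a} \<times> {0..b}) w (side_ext a b g) sequentially"
  proof (rule uniform_limitI)
    fix \<epsilon> :: real assume "\<epsilon> > 0"
    then obtain N where N: "1 / real (Suc N) < \<epsilon>"
      using reals_Archimedean by (auto simp: inverse_eq_divide)
    have "dist (w j z) (side_ext a b g z) < \<epsilon>" if "j \<ge> N" "z \<in> {0..a} \<times> {0..b}" for j z
    proof -
      have "1 / real (Suc j) \<le> 1 / real (Suc N)" using that(1) by (simp add: frac_le)
      then show ?thesis using close[OF that(2), of j] N by (simp add: dist_real_def)
    qed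
    then show "\<forall>\<^sub>F j in sequentially. \<forall>z\<in>{0..a} \<times> {0..b}. dist (w j z) (side_ext a b g z) < \<epsilon>"
      unfolding eventually_sequentially by blast
  qed
  then show "continuous_on ({0..a} \<times> {0..b}) (side_ext a b g)"
    by (rule uniform_limit_theorem[rotated]) (use wc in auto)
qed

lemma side_ext_boundary:
  assumes "a > 0" "b > 0" "g 0 = 0" "g b = 0"
  shows "side_ext a b g (0, y) = 0" "side_ext a b g (x, 0) = 0" "side_ext a b g (x, b) = 0"
    "side_ext a b g (a, y) = g y"
  using assms by (auto simp: side_ext_def side_series_boundary)

section \<open>The Dirichlet problem for Laplace's equation on a rectangle\<close>

lemma dirichlet_right:
  assumes pq: "p < q" "c < d" and g: "continuous_on {c..d} g" "g c = 0" "g d = 0"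
  shows "\<exists>w. continuous_on ({p..q} \<times> {c..d}) w \<and> C2_laplacian ({p<..<q} \<times> {c<..<d}) w (\<lambda>_. 0) \<and>
    (\<forall>y\<in>{c..d}. w (q, y) = g y \<and> w (p, y) = 0) \<and> (\<forall>x\<in>{p..q}. w (x, c) = 0 \<and> w (x, d) = 0)"
proof -
  define h where "h t = g (t + c)" for t
  have h: "continuous_on {0..d - c} h" "h 0 = 0" "h (d - c) = 0"
    unfolding h_def using g by (auto intro!: continuous_on_compose2[OF g(1)] continuous_intros)
  have hv: "h (y - c) = g y" for y by (simp add: h_def)
  have ab: "q - p > 0" "d - c > 0" using pq by auto
  let ?w = "\<lambda>(x, y). side_ext (q - p) (d - c) h (1 * x + - p, 1 * y + - c)"
  have "continuous_on ({p..q} \<times> {c..d}) ?w"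
    by (rule continuous_on_affine_pair[OF side_ext_harmonic(1)[OF ab h]]) auto
  moreover have "C2_laplacian ({p<..<q} \<times> {c<..<d}) ?w (\<lambda>(x, y). (\<lambda>_. 0) (1 * x + - p, 1 * y + - c))"
    by (rule C2_laplacian_affine[OF side_ext_harmonic(2)[OF ab h]]) auto
  ultimately show ?thesis
    using side_ext_boundary[OF ab h(2,3)] by (intro exI[of _ ?w]) (auto simp: hv case_prod_unfold)
qed

lemma dirichlet_left:
  assumes pq: "p < q" "c < d" and g: "continuous_on {c..d} g" "g c = 0" "g d = 0"
  shows "\<exists>w. continuous_on ({p..q} \<times> {c..d}) w \<and> C2_laplacian ({p<..<q} \<times> {c<..<d}) w (\<lambda>_. 0) \<and>
    (\<forall>y\<in>{c..d}. w (p, y) = g y \<and> w (q, y) = 0) \<and> (\<forall>x\<in>{p..q}. w (x, c) = 0 \<and> w (x, d) = 0)"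
proof -
  obtain w where w: "continuous_on ({-q..-p} \<times> {c..d}) w" "C2_laplacian ({-q<..<-p} \<times> {c<..<d}) w (\<lambda>_. 0)"
    "\<forall>y\<in>{c..d}. w (-p, y) = g y \<and> w (-q, y) = 0" "\<forall>x\<in>{-q..-p}. w (x, c) = 0 \<and> w (x, d) = 0"
    using dirichlet_right[of "-q" "-p" c d g] assms by auto
  let ?w = "\<lambda>(x, y). w (-1 * x + 0, 1 * y + 0)"
  have "continuous_on ({p..q} \<times> {c..d}) ?w"
    by (rule continuous_on_affine_pair[OF w(1)]) auto
  moreover have "C2_laplacian ({p<..<q} \<times> {c<..<d}) ?w (\<lambda>(x, y). (\<lambda>_. 0) (-1 * x + 0, 1 * y + 0 :: real))"
    by (rule C2_laplacian_affine[OF w(2)]) auto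
  ultimately show ?thesis
    using w(3,4) by (intro exI[of _ ?w]) (auto simp: case_prod_unfold)
qed

text \<open>The parameters \<open>r\<close> and \<open>s\<close> are meant as the ends
  \<open>c\<close>, \<open>d\<close> in either order, so one exchange of coordinates derives both
  horizontal sides from the vertical ones.\<close>

lemma dirichlet_swap:
  assumes "\<exists>w. continuous_on ({c..d} \<times> {p..q}) w \<and> C2_laplacian ({c<..<d} \<times> {p<..<q}) w (\<lambda>_. 0) \<and>
    (\<forall>x\<in>{p..q}. w (r, x) = g x \<and> w (s, x) = 0) \<and> (\<forall>y\<in>{c..d}. w (y, p) = 0 \<and> w (y, q) = 0)"
  shows "\<exists>w. continuous_on ({p..q} \<times> {c..d}) w \<and> C2_laplacian ({p<..<q} \<times> {c<..<d}) w (\<lambda>_. 0) \<and>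
    (\<forall>x\<in>{p..q}. w (x, r) = g x \<and> w (x, s) = 0) \<and> (\<forall>y\<in>{c..d}. w (p, y) = 0 \<and> w (q, y) = 0)"
proof -
  obtain w where w: "continuous_on ({c..d} \<times> {p..q}) w" "C2_laplacian ({c<..<d} \<times> {p<..<q}) w (\<lambda>_. 0)"
    "\<forall>x\<in>{p..q}. w (r, x) = g x \<and> w (s, x) = 0" "\<forall>y\<in>{c..d}. w (y, p) = 0 \<and> w (y, q) = 0"
    using assms by auto
  let ?w = "\<lambda>(x, y). w (y, x)"
  have "continuous_on ({p..q} \<times> {c..d}) ?w"
    by (rule continuous_on_swap_pair[OF w(1)]) auto
  moreover have "C2_laplacian ({p<..<q} \<times> {c<..<d}) ?w (\<lambda>(x, y). (\<lambda>_. 0) (y, x))"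
    by (rule C2_laplacian_swap[OF w(2)]) auto
  ultimately show ?thesis
    using w(3,4) by (intro exI[of _ ?w]) (auto simp: case_prod_unfold)
qed

lemma C2_laplacian_product:
  fixes X Y X' Y' X'' Y'' :: "real \<Rightarrow> real"
  assumes X: "\<And>x. x \<in> {p<..<q} \<Longrightarrow> (X has_real_derivative X' x) (at x)"
      "\<And>x. x \<in> {p<..<q} \<Longrightarrow> (X' has_real_derivative X'' x) (at x)"
      "continuous_on {p<..<q} X''"
    and Y: "\<And>y. y \<in> {c<..<d} \<Longrightarrow> (Y has_real_derivative Y' y) (at y)"
      "\<And>y. y \<in> {c<..<d} \<Longrightarrow> (Y' has_real_derivative Y'' y) (at y)"
      "continuous_on {c<..<d} Y''"
  shows "C2_laplacian ({p<..<q} \<times> {c<..<d}) (\<lambda>(x, y). X x * Y y) (\<lambda>(x, y). X'' x * Y y + X x * Y'' y)"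
proof -
  let ?S = "{p<..<q} \<times> {c<..<d}"
  have cX: "continuous_on {p<..<q} X" "continuous_on {p<..<q} X'"
    by (rule DERIV_continuous_on, use X in \<open>blast intro: DERIV_subset\<close>)+
  have cY: "continuous_on {c<..<d} Y" "continuous_on {c<..<d} Y'"
    by (rule DERIV_continuous_on, use Y in \<open>blast intro: DERIV_subset\<close>)+
  have cont: "continuous_on ?S (\<lambda>(x, y). f x * g y)"
    if f: "continuous_on {p<..<q} f" and g: "continuous_on {c<..<d} g" for f g :: "real \<Rightarrow> real"
    unfolding case_prod_unfold
    by (intro continuous_intros continuous_on_compose2[OF f] continuous_on_compose2[OF g]) auto
  have hp: "has_partials ?S (\<lambda>(x, y). f x * g y) (\<lambda>(x, y). f' x * g y) (\<lambda>(x, y). f x * g' y)"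
    if f: "continuous_on {p<..<q} f" and g: "continuous_on {c<..<d} g"
    and f': "\<And>x. x \<in> {p<..<q} \<Longrightarrow> (f has_real_derivative f' x) (at x)"
    and g': "\<And>y. y \<in> {c<..<d} \<Longrightarrow> (g has_real_derivative g' y) (at y)" for f g f' g' :: "real \<Rightarrow> real"
    using cont[OF f g] f' g' unfolding has_partials_def by (auto intro!: derivative_eq_intros)
  show ?thesis
    unfolding C2_laplacian_def
    by (rule exI[of _ "\<lambda>(x, y). X' x * Y y"], rule exI[of _ "\<lambda>(x, y). X x * Y' y"],
        rule exI[of _ "\<lambda>(x, y). X'' x * Y y"], rule exI[of _ "\<lambda>(x, y). X' x * Y' y"],
        rule exI[of _ "\<lambda>(x, y). X' x * Y' y"], rule exI[of _ "\<lambda>(x, y). X x * Y'' y"],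
        intro conjI hp cont X Y cX cY) (auto split: prod.splits)
qed

text \<open>Zero corner values make the data on each side vanish at its ends, as sine expansions
  require. The four one-sided solutions are then added; each vanishes on the other three
  sides.\<close>

lemma dirichlet_zero_corners:
  assumes pq: "p < q" "c < d" and f: "continuous_on ({p..q} \<times> {c..d}) f"
    and f0: "f (p, c) = 0" "f (p, d) = 0" "f (q, c) = 0" "f (q, d) = 0"
  shows "\<exists>w. continuous_on ({p..q} \<times> {c..d}) w \<and> C2_laplacian ({p<..<q} \<times> {c<..<d}) w (\<lambda>_. 0) \<and>
    (\<forall>y\<in>{c..d}. w (p, y) = f (p, y) \<and> w (q, y) = f (q, y)) \<and>
    (\<forall>x\<in>{p..q}. w (x, c) = f (x, c) \<and> w (x, d) = f (x, d))"
proof -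
  have c: "continuous_on {c..d} (\<lambda>y. f (r, y))" if "r \<in> {p..q}" for r
    by (rule continuous_on_compose2[OF f]) (use that in \<open>auto intro!: continuous_intros\<close>)
  have c': "continuous_on {p..q} (\<lambda>x. f (x, r))" if "r \<in> {c..d}" for r
    by (rule continuous_on_compose2[OF f]) (use that in \<open>auto intro!: continuous_intros\<close>)
  obtain w1 where w1: "continuous_on ({p..q} \<times> {c..d}) w1" "C2_laplacian ({p<..<q} \<times> {c<..<d}) w1 (\<lambda>_. 0)"
    "\<forall>y\<in>{c..d}. w1 (q, y) = f (q, y) \<and> w1 (p, y) = 0" "\<forall>x\<in>{p..q}. w1 (x, c) = 0 \<and> w1 (x, d) = 0"
    using dirichlet_right[OF pq c[of q]] pq f0 by auto
  obtain w2 where w2: "continuous_on ({p..q} \<times> {c..d}) w2" "C2_laplacian ({p<..<q} \<times> {c<..<d}) w2 (\<lambda>_. 0)"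
    "\<forall>y\<in>{c..d}. w2 (p, y) = f (p, y) \<and> w2 (q, y) = 0" "\<forall>x\<in>{p..q}. w2 (x, c) = 0 \<and> w2 (x, d) = 0"
    using dirichlet_left[OF pq c[of p]] pq f0 by auto
  obtain w3 where w3: "continuous_on ({p..q} \<times> {c..d}) w3" "C2_laplacian ({p<..<q} \<times> {c<..<d}) w3 (\<lambda>_. 0)"
    "\<forall>x\<in>{p..q}. w3 (x, d) = f (x, d) \<and> w3 (x, c) = 0" "\<forall>y\<in>{c..d}. w3 (p, y) = 0 \<and> w3 (q, y) = 0"
    using dirichlet_swap[OF dirichlet_right[OF pq(2,1) c'[of d]]] pq f0 by auto
  obtain w4 where w4: "continuous_on ({p..q} \<times> {c..d}) w4" "C2_laplacian ({p<..<q} \<times> {c<..<d}) w4 (\<lambda>_. 0)"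
    "\<forall>x\<in>{p..q}. w4 (x, c) = f (x, c) \<and> w4 (x, d) = 0" "\<forall>y\<in>{c..d}. w4 (p, y) = 0 \<and> w4 (q, y) = 0"
    using dirichlet_swap[OF dirichlet_left[OF pq(2,1) c'[of c]]] pq f0 by auto
  show ?thesis
    using C2_laplacian_add[OF C2_laplacian_add[OF w1(2) w2(2)] C2_laplacian_add[OF w3(2) w4(2)]]
      w1(1,3,4) w2(1,3,4) w3(1,3,4) w4(1,3,4)
    by (intro exI[of _ "\<lambda>z. w1 z + w2 z + (w3 z + w4 z)"]) (auto intro!: continuous_intros)
qed

lemma dirichlet_rectangle:
  assumes pq: "p < q" "c < d" and f: "continuous_on ({p..q} \<times> {c..d}) f"
  shows "\<exists>w. continuous_on ({p..q} \<times> {c..d}) w \<and> C2_laplacian ({p<..<q} \<times> {c<..<d}) w (\<lambda>_. 0) \<and>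
    (\<forall>y\<in>{c..d}. w (p, y) = f (p, y) \<and> w (q, y) = f (q, y)) \<and>
    (\<forall>x\<in>{p..q}. w (x, c) = f (x, c) \<and> w (x, d) = f (x, d))"
proof -
  define L where "L r y = ((d - y) * f (r, c) + (y - c) * f (r, d)) / (d - c)" for r y
  \<comment> \<open>The bilinear interpolation of the four corner values of \<open>f\<close>. It is
    harmonic, since both of its pure second derivatives are zero.\<close>
  define B where "B z = (\<lambda>(x, y). (q - x) / (q - p) * L p y) z + (\<lambda>(x, y). (x - p) / (q - p) * L q y) z" for z
  have L: "L r c = f (r, c)" "L r d = f (r, d)" for r using pq by (auto simp: L_def)
  have dL: "(L r has_real_derivative (f (r, d) - f (r, c)) / (d - c)) (at y)" for r y
    unfolding L_def[abs_def] using pq by (auto intro!: derivative_eq_intros simp: diff_divide_distrib)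
  have C1: "C2_laplacian ({p<..<q} \<times> {c<..<d}) (\<lambda>(x, y). (q - x) / (q - p) * L p y) (\<lambda>(x, y). 0 * L p y + (q - x) / (q - p) * 0)"
    by (rule C2_laplacian_product[OF _ _ _ dL, where X' = "\<lambda>_. - 1 / (q - p)"])
      (use pq in \<open>auto intro!: derivative_eq_intros simp: divide_simps\<close>)
  have C2: "C2_laplacian ({p<..<q} \<times> {c<..<d}) (\<lambda>(x, y). (x - p) / (q - p) * L q y) (\<lambda>(x, y). 0 * L q y + (x - p) / (q - p) * 0)"
    by (rule C2_laplacian_product[OF _ _ _ dL, where X' = "\<lambda>_. 1 / (q - p)"])
      (use pq in \<open>auto intro!: derivative_eq_intros simp: divide_simps\<close>)
  have B: "C2_laplacian ({p<..<q} \<times> {c<..<d}) B (\<lambda>_. 0)"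
    unfolding B_def[abs_def] using C2_laplacian_add[OF C1 C2] by (simp add: case_prod_unfold)
  have Bc: "continuous_on ({p..q} \<times> {c..d}) B"
    unfolding B_def[abs_def] L_def[abs_def] case_prod_unfold using pq by (intro continuous_intros) auto
  have Bv: "B (p, y) = L p y" "B (q, y) = L q y" for y using pq by (auto simp: B_def)
  obtain w where w: "continuous_on ({p..q} \<times> {c..d}) w" "C2_laplacian ({p<..<q} \<times> {c<..<d}) w (\<lambda>_. 0)"
    "\<forall>y\<in>{c..d}. w (p, y) = f (p, y) - B (p, y) \<and> w (q, y) = f (q, y) - B (q, y)"
    "\<forall>x\<in>{p..q}. w (x, c) = f (x, c) - B (x, c) \<and> w (x, d) = f (x, d) - B (x, d)"
    using dirichlet_zero_corners[OF pq continuous_on_diff[OF f Bc]] by (auto simp: Bv L)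
  show ?thesis
    using C2_laplacian_add[OF w(2) B] w(1,3,4) Bc
    by (intro exI[of _ "\<lambda>z. w z + B z"]) (auto intro!: continuous_intros)
qed

section \<open>Poisson's equation on a rectangle\<close>

text \<open>The exponent may have either sign: the quotient on the right is the integral of the
  weight in both cases. Growing and decaying weights are both needed for the kernel exp (- N |x -
  s|).\<close>

lemma integral_exp_weight_bound:
  fixes F :: "real \<Rightarrow> real"
  assumes F: "continuous_on {p..q} F" and B: "\<And>x. x \<in> {p..q} \<Longrightarrow> \<bar>F x\<bar> \<le> B" and c: "c \<noteq> 0" and pq: "p \<le> q"
  shows "\<bar>integral {p..q} (\<lambda>s. exp (c * s) * F s)\<bar> \<le> B * (exp (c * q) - exp (c * p)) / c"
proof -
  have I: "((\<lambda>s. B * exp (c * s)) has_integral (B * exp (c * q) / c - B * exp (c * p) / c)) {p..q}"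
    by (rule fundamental_theorem_of_calculus[OF pq])
      (use c in \<open>auto intro!: derivative_eq_intros simp flip: has_real_derivative_iff_has_vector_derivative\<close>)
  have "norm (integral {p..q} (\<lambda>s. exp (c * s) * F s)) \<le> integral {p..q} (\<lambda>s. B * exp (c * s))"
    by (rule integral_norm_bound_integral)
      (use B in \<open>auto intro!: integrable_continuous_real continuous_intros F simp: abs_mult mult.commute[of B] mult_left_mono\<close>)
  also have "\<dots> = B * (exp (c * q) - exp (c * p)) / c"
    unfolding integral_unique[OF I] by (simp add: right_diff_distrib diff_divide_distrib)
  finally show ?thesis by simp
qed

text \<open>The solution is -1 / (2 N) times the integral of exp (- N |x - s|) F s, cut at s = x
  into \<open>I\<close> and \<open>J\<close>. The kernel has total mass at most 2 / N, which gives
  the bound B / N^2. No end values are prescribed, as the boundary values are corrected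
  later.\<close>

lemma bounded_solution_ode:
  fixes F :: "real \<Rightarrow> real"
  assumes N: "N > 0" and pq: "p < q" and F: "continuous_on {p..q} F"
    and B: "\<And>x. x \<in> {p..q} \<Longrightarrow> \<bar>F x\<bar> \<le> B"
  shows "\<exists>u u'. continuous_on {p..q} u \<and>
    (\<forall>x\<in>{p<..<q}. (u has_real_derivative u' x) (at x) \<and> (u' has_real_derivative N\<^sup>2 * u x + F x) (at x)) \<and>
    (\<forall>x\<in>{p..q}. \<bar>u x\<bar> \<le> B / N\<^sup>2 \<and> \<bar>u' x\<bar> \<le> B / N)"
proof -
  define I where "I x = integral {p..x} (\<lambda>s. exp (N * s) * F s)" for x
  define J where "J x = integral {x..q} (\<lambda>s. exp (- N * s) * F s)" for x
  define u where "u x = - (exp (- N * x) * I x + exp (N * x) * J x) / (2 * N)" for x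
  define u' where "u' x = (exp (- N * x) * I x - exp (N * x) * J x) / 2" for x
  have dI: "(I has_real_derivative exp (N * x) * F x) (at x within {p..q})" if "x \<in> {p..q}" for x
    unfolding I_def[abs_def]
    by (rule integral_has_real_derivative[OF _ that]) (intro continuous_intros F)
  have dJ: "(J has_real_derivative - (exp (- N * x) * F x)) (at x within {p..q})" if "x \<in> {p..q}" for x
    unfolding J_def[abs_def]
    by (rule integral_has_real_derivative'[OF _ that]) (intro continuous_intros F)
  have cI: "continuous_on {p..q} I" "continuous_on {p..q} J"
    by (rule DERIV_continuous_on[OF dI], simp, rule DERIV_continuous_on[OF dJ], simp)
  have 1: "continuous_on {p..q} u"
    unfolding u_def[abs_def] using N by (intro continuous_intros cI) auto
  have 2: "(u has_real_derivative u' x) (at x)" "(u' has_real_derivative N\<^sup>2 * u x + F x) (at x)"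
    if x: "x \<in> {p<..<q}" for x
  proof -
    have at: "at x within {p..q} = at x" using x by (simp add: at_within_Icc_at)
    note d = dI[of x, unfolded at] dJ[of x, unfolded at]
    \<comment> \<open>The terms that come from differentiating the integration limits are plus or
      minus \<open>F x\<close>: they cancel in the first derivative and add up to the right-hand
      side in the second.\<close>
    have ee: "exp (- N * x) * exp (N * x) = 1" "exp (N * x) * exp (- N * x) = 1" by (simp_all flip: exp_add)
    have "(u has_real_derivative - ((- N * exp (- N * x)) * I x + exp (- N * x) * (exp (N * x) * F x)
        + ((N * exp (N * x)) * J x + exp (N * x) * - (exp (- N * x) * F x))) / (2 * N)) (at x)"
      unfolding u_def[abs_def] using x N by (auto intro!: derivative_eq_intros d simp: field_simps)
    also have "- ((- N * exp (- N * x)) * I x + exp (- N * x) * (exp (N * x) * F x)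
        + ((N * exp (N * x)) * J x + exp (N * x) * - (exp (- N * x) * F x))) / (2 * N) = u' x"
      unfolding mult_minus_right mult.assoc[symmetric] ee using N by (simp add: u'_def field_simps)
    finally show "(u has_real_derivative u' x) (at x)" .
    have "(u' has_real_derivative ((- N * exp (- N * x)) * I x + exp (- N * x) * (exp (N * x) * F x)
        - ((N * exp (N * x)) * J x + exp (N * x) * - (exp (- N * x) * F x))) / 2) (at x)"
      unfolding u'_def[abs_def] using x by (auto intro!: derivative_eq_intros d simp: field_simps)
    also have "((- N * exp (- N * x)) * I x + exp (- N * x) * (exp (N * x) * F x)
        - ((N * exp (N * x)) * J x + exp (N * x) * - (exp (- N * x) * F x))) / 2 = N\<^sup>2 * u x + F x"
      unfolding mult_minus_right mult.assoc[symmetric] ee using N by (simp add: u_def field_simps power2_eq_square)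
    finally show "(u' has_real_derivative N\<^sup>2 * u x + F x) (at x)" .
  qed
  have 3: "\<bar>u x\<bar> \<le> B / N\<^sup>2" "\<bar>u' x\<bar> \<le> B / N" if x: "x \<in> {p..q}" for x
  proof -
    have B0: "0 \<le> B" using order.trans[OF abs_ge_zero B[OF x]] .
    have "\<bar>I x\<bar> \<le> B * (exp (N * x) - exp (N * p)) / N"
      unfolding I_def
      by (rule integral_exp_weight_bound) (use x N B in \<open>auto intro: continuous_on_subset[OF F]\<close>)
    also have "\<dots> \<le> B * exp (N * x) / N" using B0 N by (intro divide_right_mono mult_left_mono) auto
    finally have "exp (- N * x) * \<bar>I x\<bar> \<le> exp (- N * x) * (B * exp (N * x) / N)" by (intro mult_left_mono) auto
    also have "\<dots> = B / N" by (simp add: exp_minus)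
    finally have i: "\<bar>exp (- N * x) * I x\<bar> \<le> B / N" by (simp add: abs_mult)
    have "\<bar>J x\<bar> \<le> B * (exp (- N * q) - exp (- N * x)) / - N"
      unfolding J_def
      by (rule integral_exp_weight_bound) (use x N B in \<open>auto intro: continuous_on_subset[OF F]\<close>)
    also have "\<dots> = B * (exp (- N * x) - exp (- N * q)) / N" using N by (simp add: field_simps)
    also have "\<dots> \<le> B * exp (- N * x) / N" using B0 N by (intro divide_right_mono mult_left_mono) auto
    finally have "exp (N * x) * \<bar>J x\<bar> \<le> exp (N * x) * (B * exp (- N * x) / N)" by (intro mult_left_mono) auto
    also have "\<dots> = B / N" by (simp add: exp_minus)
    finally have j: "\<bar>exp (N * x) * J x\<bar> \<le> B / N" by (simp add: abs_mult)
    have "\<bar>u x\<bar> = \<bar>exp (- N * x) * I x + exp (N * x) * J x\<bar> / (2 * N)" using N by (simp add: u_def abs_divide)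
    also have "\<dots> \<le> (B / N + B / N) / (2 * N)" using i j N by (intro divide_right_mono) auto
    also have "\<dots> = B / N\<^sup>2" using N by (simp add: field_simps power2_eq_square)
    finally show "\<bar>u x\<bar> \<le> B / N\<^sup>2" .
    have "\<bar>(r - t) / 2\<bar> \<le> K" if "\<bar>r\<bar> \<le> K" "\<bar>t\<bar> \<le> K" for r t K :: real
      using abs_triangle_ineq4[of r t] that by simp
    from this[OF i j] show "\<bar>u' x\<bar> \<le> B / N" unfolding u'_def .
  qed
  show ?thesis by (rule exI[of _ u], rule exI[of _ u']) (use 1 2 3 in auto)
qed

lemma second_antiderivative:
  fixes a :: "real \<Rightarrow> real"
  assumes a: "continuous_on {p..q} a"
  shows "\<exists>A A'. continuous_on {p..q} A \<and>
    (\<forall>x\<in>{p<..<q}. (A has_real_derivative A' x) (at x) \<and> (A' has_real_derivative a x) (at x))"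
proof -
  define A' where "A' x = integral {p..x} a" for x
  define A where "A x = integral {p..x} A'" for x
  have d': "(A' has_real_derivative a x) (at x within {p..q})" if "x \<in> {p..q}" for x
    unfolding A'_def[abs_def] by (rule integral_has_real_derivative[OF a that])
  have c': "continuous_on {p..q} A'" by (rule DERIV_continuous_on[OF d'])
  have d: "(A has_real_derivative A' x) (at x within {p..q})" if "x \<in> {p..q}" for x
    unfolding A_def[abs_def] by (rule integral_has_real_derivative[OF c' that])
  have "continuous_on {p..q} A" by (rule DERIV_continuous_on[OF d])
  moreover have "(A has_real_derivative A' x) (at x)" "(A' has_real_derivative a x) (at x)" if "x \<in> {p<..<q}" for x
    using d[of x] d'[of x] that by (auto simp: at_within_Icc_at)
  ultimately show ?thesis by blast
qed

text \<open>Integration by parts in x2 calls for vertical derivatives. Here \<open>g\<close> and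
  \<open>h\<close> are the continuous extensions of \<open>pd2 f\<close> and
  \<open>pd2 (pd2 f)\<close> to the closed rectangle, and compactness then bounds \<open>h\<close>
  uniformly in x.\<close>

lemma Ck_closure_2_vertical:
  assumes f: "Ck_closure 2 ({p<..<q} \<times> {c<..<d}) f" and pq: "p < q" "c < d"
  obtains g h where "continuous_on ({p..q} \<times> {c..d}) f" "continuous_on ({p..q} \<times> {c..d}) g"
    "continuous_on ({p..q} \<times> {c..d}) h"
    "\<And>x y. x \<in> {p<..<q} \<Longrightarrow> y \<in> {c<..<d} \<Longrightarrow> ((\<lambda>t. f (x, t)) has_real_derivative g (x, y)) (at y)"
    "\<And>x y. x \<in> {p<..<q} \<Longrightarrow> y \<in> {c<..<d} \<Longrightarrow> ((\<lambda>t. g (x, t)) has_real_derivative h (x, y)) (at y)"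
proof -
  let ?S = "{p<..<q} \<times> {c<..<d}"
  have cl: "closure ?S = {p..q} \<times> {c..d}" using pq by (simp add: closure_Times)
  have E: "continuous_on ({p..q} \<times> {c..d}) f" "has_pds_on ?S f" "has_pds_on ?S (pd2 f)"
    "extends_continuously ?S (pd2 f)" "extends_continuously ?S (pd2 (pd2 f))"
    using f by (auto simp: Ck_closure_def numeral_2_eq_2 cl)
  obtain g where g: "continuous_on ({p..q} \<times> {c..d}) g" "\<And>z. z \<in> ?S \<Longrightarrow> g z = pd2 f z"
    using E(4) unfolding extends_continuously_def cl by auto
  obtain h where h: "continuous_on ({p..q} \<times> {c..d}) h" "\<And>z. z \<in> ?S \<Longrightarrow> h z = pd2 (pd2 f) z"
    using E(5) unfolding extends_continuously_def cl by auto
  have D: "((\<lambda>t. w (x, t)) has_real_derivative pd2 w (x, y)) (at y)"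
    if "has_pds_on ?S w" "x \<in> {p<..<q}" "y \<in> {c<..<d}" for w x y
  proof -
    have "(\<lambda>t. w (x, t)) field_differentiable at y"
      using that unfolding has_pds_on_def by blast
    then show ?thesis unfolding pd2_def by (simp add: DERIV_deriv_iff_field_differentiable)
  qed
  show ?thesis
  proof (rule that[OF E(1) g(1) h(1)])
    fix x y assume x: "x \<in> {p<..<q}" and y: "y \<in> {c<..<d}"
    show "((\<lambda>t. f (x, t)) has_real_derivative g (x, y)) (at y)"
      using D[OF E(2) x y] g(2)[of "(x, y)"] x y by simp
    have "((\<lambda>t. pd2 f (x, t)) has_real_derivative h (x, y)) (at y)"
      using D[OF E(3) x y] h(2)[of "(x, y)"] x y by simp
    then show "((\<lambda>t. g (x, t)) has_real_derivative h (x, y)) (at y)"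
      by (rule has_field_derivative_transform_within_open[of _ _ _ "{c<..<d}"]) (use x y g(2) in auto)
  qed
qed

text \<open>The part \<open>f0\<close>, which vanishes at y = 0 and y = 1, is handled by the sine
  series. The interpolated part f (x, 0) (1 - y) + f (x, 1) y is solved explicitly by A x (1 - y) +
  D x y, where A'' and D'' are the two boundary traces of \<open>f\<close>.\<close>

lemma poisson_particular_solution:
  assumes f: "Ck_closure 2 ({p<..<q} \<times> {0<..<1}) f" and pq: "p < q"
  shows "\<exists>V. continuous_on ({p..q} \<times> {0..1}) V \<and> C2_laplacian ({p<..<q} \<times> {0<..<1}) V f"
proof -
  let ?K = "{p..q} \<times> {0..1::real}"
  obtain g h where fc: "continuous_on ?K f" and g: "continuous_on ?K g" and h: "continuous_on ?K h"
    and df: "\<And>x y. x \<in> {p<..<q} \<Longrightarrow> y \<in> {0<..<1} \<Longrightarrow> ((\<lambda>t. f (x, t)) has_real_derivative g (x, y)) (at y)"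
    and dg: "\<And>x y. x \<in> {p<..<q} \<Longrightarrow> y \<in> {0<..<1} \<Longrightarrow> ((\<lambda>t. g (x, t)) has_real_derivative h (x, y)) (at y)"
    using Ck_closure_2_vertical[OF f pq] by auto
  have slice: "continuous_on {0..1} (\<lambda>y. w (x, y))" if "continuous_on ?K w" "x \<in> {p..q}" for w :: "real \<times> real \<Rightarrow> real" and x
    by (rule continuous_on_compose2[OF that(1)]) (use that in \<open>auto intro!: continuous_intros\<close>)
  have slice': "continuous_on {p..q} (\<lambda>x. f (x, y))" if "y \<in> {0..1}" for y
    by (rule continuous_on_compose2[OF fc]) (use that in \<open>auto intro!: continuous_intros\<close>)
  define f0 where "f0 x y = f (x, y) - (f (x, 0) * (1 - y) + f (x, 1) * y)" for x y
  have f0c: "continuous_on ?K (\<lambda>(x, y). f0 x y)"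
    unfolding f0_def case_prod_unfold
    by (intro continuous_intros continuous_on_compose2[OF slice'] continuous_on_compose2[OF fc]) auto
  have f0y: "continuous_on {0..1} (f0 x)" if "x \<in> {p..q}" for x
    unfolding f0_def[abs_def] by (intro continuous_intros slice fc that)
  have f0e: "f0 x 0 = 0" "f0 x 1 = 0" for x by (simp_all add: f0_def)
  define F where "F n x = sine_coeff 1 (f0 x) n" for n x
  have Fc: "continuous_on {p..q} (F n)" for n
  proof -
    have "continuous_on ?K (\<lambda>z. (\<lambda>(x, y). f0 x y) z * sin (nu 1 n * snd z))"
      by (intro continuous_intros f0c)
    then have "continuous_on ({p..q} \<times> cbox 0 1) (\<lambda>(x, y). f0 x y * sin (nu 1 n * y))"
      by (simp add: case_prod_unfold)
    from integral_continuous_on_param[OF this] show ?thesis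
      unfolding F_def[abs_def] sine_coeff_def by (auto intro!: continuous_intros)
  qed
  obtain C where C: "\<And>z. z \<in> ?K \<Longrightarrow> \<bar>h z\<bar> \<le> C"
    using compact_imp_bounded[OF compact_continuous_image[OF h compact_Times[OF compact_Icc compact_Icc]]]
    unfolding bounded_pos by (auto simp del: atLeastAtMost_iff)
  have C0: "C \<ge> 0" using order.trans[OF abs_ge_zero C[of "(p, 0)"]] pq by simp
  \<comment> \<open>The interpolation is affine in y, so the second vertical derivative of
    \<open>f0\<close> is \<open>h\<close>. Two integrations by parts bound its coefficients by this
    number, for all x at once.\<close>
  define B where "B n = 2 * C / (nu 1 n)\<^sup>2" for n
  have FBint: "\<bar>F n x\<bar> \<le> B n" if x: "x \<in> {p<..<q}" for n x
  proof -
    have x': "x \<in> {p..q}" using x by auto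
    have "F n x = - sine_coeff 1 (\<lambda>y. h (x, y)) n / (nu 1 n)\<^sup>2"
      unfolding F_def
    proof (rule sine_coeff_parts[where e = "\<lambda>y. g (x, y) - (f (x, 1) - f (x, 0))"])
      show "continuous_on {0..1} (\<lambda>y. g (x, y) - (f (x, 1) - f (x, 0)))"
        by (intro continuous_intros slice g x')
      fix y :: real assume y: "y \<in> {0<..<1}"
      show "(f0 x has_real_derivative g (x, y) - (f (x, 1) - f (x, 0))) (at y)"
        unfolding f0_def[abs_def] by (auto intro!: derivative_eq_intros df[OF x y])
      show "((\<lambda>y. g (x, y) - (f (x, 1) - f (x, 0))) has_real_derivative h (x, y)) (at y)"
        by (auto intro!: derivative_eq_intros dg[OF x y])
    qed (auto simp: f0e intro: f0y[OF x'] slice[OF h x'])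
    moreover have "\<bar>sine_coeff 1 (\<lambda>y. h (x, y)) n\<bar> \<le> 2 * C"
      by (rule sine_coeff_bound[OF _ slice[OF h x']]) (use C x' in auto)
    ultimately show ?thesis by (simp add: B_def divide_right_mono)
  qed
  \<comment> \<open>The vertical derivatives are available for interior x only; continuity of
    \<open>F n\<close> carries the bound to the two ends, where the ordinary differential equation
    needs it.\<close>
  have FB: "\<bar>F n x\<bar> \<le> B n" if x: "x \<in> {p..q}" for n x
    by (rule continuous_le_on_closure[of "{p<..<q}" "\<lambda>x. \<bar>F n x\<bar>"])
      (use x pq FBint in \<open>auto intro!: continuous_intros Fc\<close>)
  have nu1: "nu 1 n \<ge> 1" for n
  proof -
    have "1 * 1 \<le> real (Suc n) * pi" using pi_gt3 by (intro mult_mono) auto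
    then show ?thesis by (simp add: nu_def)
  qed
  have "\<forall>n. \<exists>u u'. continuous_on {p..q} u \<and>
    (\<forall>x\<in>{p<..<q}. (u has_real_derivative u' x) (at x) \<and> (u' has_real_derivative (nu 1 n)\<^sup>2 * u x + F n x) (at x)) \<and>
    (\<forall>x\<in>{p..q}. \<bar>u x\<bar> \<le> B n / (nu 1 n)\<^sup>2 \<and> \<bar>u' x\<bar> \<le> B n / nu 1 n)"
    by (intro allI bounded_solution_ode pq Fc FB nu_pos) auto
  then obtain u u' where u: "\<And>n. continuous_on {p..q} (u n)"
    "\<And>n x. x \<in> {p<..<q} \<Longrightarrow> (u n has_real_derivative u' n x) (at x)"
    "\<And>n x. x \<in> {p<..<q} \<Longrightarrow> (u' n has_real_derivative (nu 1 n)\<^sup>2 * u n x + F n x) (at x)"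
    "\<And>n x. x \<in> {p..q} \<Longrightarrow> \<bar>u n x\<bar> \<le> B n / (nu 1 n)\<^sup>2"
    "\<And>n x. x \<in> {p..q} \<Longrightarrow> \<bar>u' n x\<bar> \<le> B n / nu 1 n" by metis
  have B0: "0 \<le> B n" for n using C0 by (simp add: B_def)
  have sB: "summable B" unfolding B_def[abs_def] by (rule summable_inverse_nu_sq) simp
  \<comment> \<open>As all frequencies are at least 1, the bounds on \<open>u n\<close> and
    \<open>u' n\<close> leave every needed product with a power of the frequency below the summable
    \<open>B n\<close>.\<close>
  have ub: "nu 1 n ^ 2 * \<bar>u n x\<bar> \<le> B n" "nu 1 n * \<bar>u n x\<bar> \<le> B n" "\<bar>u n x\<bar> \<le> B n"
    "nu 1 n * \<bar>u' n x\<bar> \<le> B n" "\<bar>u' n x\<bar> \<le> B n" if x: "x \<in> {p..q}" for n x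
  proof -
    let ?N = "nu 1 n"
    have N: "?N \<ge> 1" by (rule nu1)
    show 1: "?N ^ 2 * \<bar>u n x\<bar> \<le> B n" using u(4)[OF x, of n] N by (simp add: pos_le_divide_eq mult.commute)
    have "\<bar>u n x\<bar> * ?N ^ 1 \<le> \<bar>u n x\<bar> * ?N ^ 2" "\<bar>u n x\<bar> * ?N ^ 0 \<le> \<bar>u n x\<bar> * ?N ^ 2"
      using N by (intro mult_left_mono power_increasing; simp)+
    then show "?N * \<bar>u n x\<bar> \<le> B n" "\<bar>u n x\<bar> \<le> B n" using 1 by (simp_all add: mult.commute)
    show 2: "?N * \<bar>u' n x\<bar> \<le> B n" using u(5)[OF x, of n] N by (simp add: pos_le_divide_eq mult.commute)
    have "1 * \<bar>u' n x\<bar> \<le> ?N * \<bar>u' n x\<bar>" using N by (intro mult_right_mono) auto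
    then show "\<bar>u' n x\<bar> \<le> B n" using 2 by simp
  qed
  have trig: "\<bar>r * sin t\<bar> \<le> \<bar>r\<bar>" "\<bar>r * cos t\<bar> \<le> \<bar>r\<bar>" for r t :: real
    by (simp_all add: abs_mult mult_left_le)
  define V0 where "V0 = (\<lambda>(x, y). \<Sum>n. u n x * sin (nu 1 n * y))"
  have V0c: "continuous_on ?K V0"
    unfolding V0_def
    by (rule continuous_on_product_series[OF u(1) _ _ sB])
      (auto intro!: continuous_intros order.trans[OF trig(1) ub(3)])
  have "C2_laplacian ({p<..<q} \<times> {0<..<1}) V0 (\<lambda>(x, y). \<Sum>n. ((nu 1 n)\<^sup>2 * u n x + F n x) * sin (nu 1 n * y)
      + u n x * (- (nu 1 n ^ 2 * sin (nu 1 n * y))))"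
    unfolding V0_def
  proof (rule C2_laplacian_product_series[OF u(2,3), where M = "\<lambda>n. B n + B n" and Y' = "\<lambda>n y. nu 1 n * cos (nu 1 n * y)"])
    show "summable (\<lambda>n. B n + B n)" by (intro summable_add sB)
    fix n
    show "continuous_on {p<..<q} (\<lambda>x. (nu 1 n)\<^sup>2 * u n x + F n x)"
      by (intro continuous_intros continuous_on_subset[OF u(1)] continuous_on_subset[OF Fc]) auto
    show "((\<lambda>y. sin (nu 1 n * y)) has_real_derivative nu 1 n * cos (nu 1 n * y)) (at y)" for y
      by (auto intro!: derivative_eq_intros)
    show "((\<lambda>y. nu 1 n * cos (nu 1 n * y)) has_real_derivative - (nu 1 n ^ 2 * sin (nu 1 n * y))) (at y)" for y
      by (auto intro!: derivative_eq_intros simp: power2_eq_square)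
    show "continuous_on {0<..<1} (\<lambda>y. - (nu 1 n ^ 2 * sin (nu 1 n * y)))"
      by (intro continuous_intros)
    fix x y :: real assume "x \<in> {p<..<q}" and y: "y \<in> {0<..<1}"
    then have x: "x \<in> {p..q}" by auto
    have N: "nu 1 n > 0" by (simp add: nu_pos)
    \<comment> \<open>The second derivative of \<open>u n\<close> is a sum of two terms of size
      \<open>B n\<close>, hence the doubled majorant.\<close>
    have 3: "\<bar>(nu 1 n)\<^sup>2 * u n x + F n x\<bar> \<le> B n + B n"
      using ub(1)[OF x, of n] FB[OF x, of n] abs_triangle_ineq[of "(nu 1 n)\<^sup>2 * u n x" "F n x"]
      by (simp add: abs_mult)
    have 4: "\<bar>u n x * (nu 1 n * cos (nu 1 n * y))\<bar> \<le> B n" "\<bar>u' n x * (nu 1 n * cos (nu 1 n * y))\<bar> \<le> B n"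
      "\<bar>u n x * (- (nu 1 n ^ 2 * sin (nu 1 n * y)))\<bar> \<le> B n"
      using order.trans[OF trig(2) , of "u n x * nu 1 n" "B n" "nu 1 n * y"] ub(2)[OF x, of n]
        order.trans[OF trig(2) , of "u' n x * nu 1 n" "B n" "nu 1 n * y"] ub(4)[OF x, of n]
        order.trans[OF trig(1) , of "u n x * nu 1 n ^ 2" "B n" "nu 1 n * y"] ub(1)[OF x, of n] N
      by (simp_all add: abs_mult mult_ac)
    show "\<bar>u n x * sin (nu 1 n * y)\<bar> \<le> B n + B n \<and> \<bar>u' n x * sin (nu 1 n * y)\<bar> \<le> B n + B n \<and>
      \<bar>u n x * (nu 1 n * cos (nu 1 n * y))\<bar> \<le> B n + B n \<and>
      \<bar>((nu 1 n)\<^sup>2 * u n x + F n x) * sin (nu 1 n * y)\<bar> \<le> B n + B n \<and>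
      \<bar>u' n x * (nu 1 n * cos (nu 1 n * y))\<bar> \<le> B n + B n \<and>
      \<bar>u n x * (- (nu 1 n ^ 2 * sin (nu 1 n * y)))\<bar> \<le> B n + B n"
      using order.trans[OF trig(1) ub(3)[OF x], of n "nu 1 n * y"] order.trans[OF trig(1) ub(5)[OF x], of n "nu 1 n * y"]
        order.trans[OF trig(1) 3, of "nu 1 n * y"] 4 B0[of n] by (intro conjI) linarith+
  qed
  \<comment> \<open>The terms with the squared frequency cancel, which leaves the sine series of
    \<open>f0 x\<close>; its summable coefficients and zero end values make it sum to
    \<open>f0 x\<close>.\<close>
  then have V0: "C2_laplacian ({p<..<q} \<times> {0<..<1}) V0 (\<lambda>(x, y). f0 x y)"
  proof (rule C2_laplacian_cong[rotated])
    fix z assume z: "z \<in> {p<..<q} \<times> {0<..<1::real}"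
    obtain x y where xy: "z = (x, y)" "x \<in> {p<..<q}" "x \<in> {p..q}" "y \<in> {0..1}" using z by auto
    have s: "summable (\<lambda>n. \<bar>sine_coeff 1 (f0 x) n\<bar>)"
      by (rule summable_comparison_test'[OF sB]) (use FB[OF xy(3)] in \<open>simp add: F_def\<close>)
    have "f0 x y = sine_sum 1 (sine_coeff 1 (f0 x)) y"
      using sine_sum_sine_coeff[OF _ f0y[OF xy(3)] f0e s xy(4)] by simp
    then show "(\<lambda>(x, y). f0 x y) z = (\<lambda>(x, y). \<Sum>n. ((nu 1 n)\<^sup>2 * u n x + F n x) * sin (nu 1 n * y)
      + u n x * (- (nu 1 n ^ 2 * sin (nu 1 n * y)))) z"
      by (simp add: xy(1) sine_sum_def F_def algebra_simps)
  qed (auto intro!: open_Times)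
  obtain A A' where A: "continuous_on {p..q} A" "\<And>x. x \<in> {p<..<q} \<Longrightarrow> (A has_real_derivative A' x) (at x)"
    "\<And>x. x \<in> {p<..<q} \<Longrightarrow> (A' has_real_derivative f (x, 0)) (at x)"
    using second_antiderivative[OF slice'[of 0]] by (auto simp del: greaterThanLessThan_iff)
  obtain D D' where D: "continuous_on {p..q} D" "\<And>x. x \<in> {p<..<q} \<Longrightarrow> (D has_real_derivative D' x) (at x)"
    "\<And>x. x \<in> {p<..<q} \<Longrightarrow> (D' has_real_derivative f (x, 1)) (at x)"
    using second_antiderivative[OF slice'[of 1]] by (auto simp del: greaterThanLessThan_iff)
  have VA: "C2_laplacian ({p<..<q} \<times> {0<..<1}) (\<lambda>(x, y). A x * (1 - y)) (\<lambda>(x, y). f (x, 0) * (1 - y) + A x * 0)"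
    by (rule C2_laplacian_product[OF A(2,3), where Y' = "\<lambda>_. -1"])
      (auto intro!: derivative_eq_intros continuous_on_subset[OF slice'])
  have VD: "C2_laplacian ({p<..<q} \<times> {0<..<1}) (\<lambda>(x, y). D x * y) (\<lambda>(x, y). f (x, 1) * y + D x * 0)"
    by (rule C2_laplacian_product[OF D(2,3), where Y' = "\<lambda>_. 1"])
      (auto intro!: derivative_eq_intros continuous_on_subset[OF slice'])
  have "C2_laplacian ({p<..<q} \<times> {0<..<1}) (\<lambda>z. V0 z + ((\<lambda>(x, y). A x * (1 - y)) z + (\<lambda>(x, y). D x * y) z)) f"
    by (rule C2_laplacian_cong[OF _ C2_laplacian_add[OF V0 C2_laplacian_add[OF VA VD]]])
      (auto intro!: open_Times simp: f0_def)
  moreover have "continuous_on ?K (\<lambda>z. V0 z + ((\<lambda>(x, y). A x * (1 - y)) z + (\<lambda>(x, y). D x * y) z))"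
    unfolding case_prod_unfold
    by (intro continuous_intros V0c continuous_on_compose2[OF A(1)] continuous_on_compose2[OF D(1)]) auto
  ultimately show ?thesis by blast
qed

lemma poisson_zero_boundary:
  assumes f: "Ck_closure 2 ({p<..<q} \<times> {0<..<1}) f" and pq: "p < q"
  obtains P where "continuous_on ({p..q} \<times> {0..1}) P" "C2_laplacian ({p<..<q} \<times> {0<..<1}) P f"
    "\<And>y. y \<in> {0..1} \<Longrightarrow> P (p, y) = 0" "\<And>y. y \<in> {0..1} \<Longrightarrow> P (q, y) = 0"
    "\<And>x. x \<in> {p..q} \<Longrightarrow> P (x, 0) = 0" "\<And>x. x \<in> {p..q} \<Longrightarrow> P (x, 1) = 0"
proof -
  obtain V where V: "continuous_on ({p..q} \<times> {0..1}) V" "C2_laplacian ({p<..<q} \<times> {0<..<1}) V f"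
    using poisson_particular_solution[OF f pq] by auto
  obtain w where w: "continuous_on ({p..q} \<times> {0..1}) w" "C2_laplacian ({p<..<q} \<times> {0<..<1}) w (\<lambda>_. 0)"
    "\<forall>y\<in>{0..1}. w (p, y) = V (p, y) \<and> w (q, y) = V (q, y)"
    "\<forall>x\<in>{p..q}. w (x, 0) = V (x, 0) \<and> w (x, 1) = V (x, 1)"
    using dirichlet_rectangle[OF pq zero_less_one V(1)] by blast
  show ?thesis
    by (rule that[of "\<lambda>z. V z - w z"])
      (use C2_laplacian_diff[OF V(2) w(2)] V(1) w in \<open>auto intro!: continuous_intros\<close>)
qed

section \<open>The nonlocal contact problem\<close>

text \<open>Affine functions of x are harmonic, so the maximum principle applies to w and -w minus
  the affine bound. Its nonnegativity covers the horizontal sides, where \<open>w\<close> is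
  zero.\<close>

lemma max_principle_affine:
  fixes w :: "real \<times> real \<Rightarrow> real"
  assumes pq: "p < q"
    and cont: "continuous_on ({p..q} \<times> {0..1}) w"
    and C2: "C2_laplacian ({p<..<q} \<times> {0<..<1}) w (\<lambda>_. 0)"
    and l: "\<And>x. x \<in> {p..q} \<Longrightarrow> 0 \<le> \<alpha> + \<beta> * x"
    and bd: "\<And>x. x \<in> {p..q} \<Longrightarrow> w (x, 0) = 0" "\<And>x. x \<in> {p..q} \<Longrightarrow> w (x, 1) = 0"
      "\<And>y. y \<in> {0..1} \<Longrightarrow> \<bar>w (p, y)\<bar> \<le> \<alpha> + \<beta> * p" "\<And>y. y \<in> {0..1} \<Longrightarrow> \<bar>w (q, y)\<bar> \<le> \<alpha> + \<beta> * q"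
    and z: "x \<in> {p..q}" "y \<in> {0..1}"
  shows "\<bar>w (x, y)\<bar> \<le> \<alpha> + \<beta> * x"
proof -
  have L: "C2_laplacian ({p<..<q} \<times> {0<..<1}) (\<lambda>(x, y). (\<alpha> + \<beta> * x) * 1) (\<lambda>(x, y). 0 * 1 + (\<alpha> + \<beta> * x) * 0)"
    by (rule C2_laplacian_product[where X' = "\<lambda>_. \<beta>" and Y' = "\<lambda>_. 0"]) (auto intro!: derivative_eq_intros)
  have le: "s * w (x, y) \<le> \<alpha> + \<beta> * x" if s: "s = 1 \<or> s = -1" for s :: real
  proof -
    have "s * w (x, y) + (-1) * (\<lambda>(x, y). (\<alpha> + \<beta> * x) * 1) (x, y) \<le> 0"
    proof (rule max_principle[OF pq])
      show "C2_laplacian ({p<..<q} \<times> {0<..<1}) (\<lambda>z. s * w z + (-1) * (\<lambda>(x, y). (\<alpha> + \<beta> * x) * 1) z) (\<lambda>_. 0)"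
        using C2_laplacian_lin[OF C2 L, of s "-1"] by (simp add: case_prod_unfold)
      show "continuous_on ({p..q} \<times> {0..1}) (\<lambda>z. s * w z + (-1) * (\<lambda>(x, y). (\<alpha> + \<beta> * x) * 1) z)"
        unfolding case_prod_unfold by (intro continuous_intros cont)
      show "s * w (p, y) + -1 * (case (p, y) of (x, y) \<Rightarrow> (\<alpha> + \<beta> * x) * 1) \<le> 0" if "y \<in> {0..1}" for y
        using bd(3)[OF that] s by (auto simp: abs_le_iff)
      show "s * w (q, y) + -1 * (case (q, y) of (x, y) \<Rightarrow> (\<alpha> + \<beta> * x) * 1) \<le> 0" if "y \<in> {0..1}" for y
        using bd(4)[OF that] s by (auto simp: abs_le_iff)
      show "s * w (x, 0) + -1 * (case (x, 0) of (x, y) \<Rightarrow> (\<alpha> + \<beta> * x) * 1) \<le> 0" if "x \<in> {p..q}" for x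
        using bd(1)[OF that] l[OF that] by simp
      show "s * w (x, 1) + -1 * (case (x, 1) of (x, y) \<Rightarrow> (\<alpha> + \<beta> * x) * 1) \<le> 0" if "x \<in> {p..q}" for x
        using bd(2)[OF that] l[OF that] by simp
    qed (use z in auto)
    then show ?thesis by simp
  qed
  show ?thesis using le[of 1] le[of "-1"] by (simp add: abs_le_iff)
qed

text \<open>The arguments \<open>1 - xp\<close> and \<open>1 - x0\<close> stem from reflecting the
  right rectangle, which turns the contact line into the side carrying the data. The required
  coefficients are \<open>c\<close>, but they are merely bounded and define no continuous function
  directly. Writing c = h_n + c \<mu> isolates a correction with absolutely summable
  coefficients.\<close>

lemma nonlocal_trace:
  assumes x: "0 < xm" "xm < x0" "x0 < xp" "xp < 1"
    and \<gamma>: "gm > 0" "gp > 0" "gm + gp \<le> 1"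
    and h: "continuous_on {0..1} h" "h 0 = 0" "h 1 = 0"
  obtains g where "continuous_on {0..1} g" "g 0 = 0" "g 1 = 0"
    "\<And>y. g y = gm * side_ext x0 1 g (xm, y) + gp * side_ext (1 - x0) 1 g (1 - xp, y) + h y"
proof -
  define r where "r n = sinh (nu 1 n * xm) / sinh (nu 1 n * x0)" for n
  define s where "s n = sinh (nu 1 n * (1 - xp)) / sinh (nu 1 n * (1 - x0))" for n
  \<comment> \<open>The decay of the lowest mode over the distance from the contact line to
    \<open>xm\<close> and to \<open>xp\<close>. It dominates all modes, and since the weights
    \<open>gm\<close>, \<open>gp\<close> sum to at most 1, it bounds \<open>\<mu>\<close> as
    well.\<close>
  define \<rho> where "\<rho> = max (exp (- (nu 1 0 * (x0 - xm)))) (exp (- (nu 1 0 * ((1 - x0) - (1 - xp)))))"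
  define \<mu> where "\<mu> n = gm * r n + gp * s n" for n
  have \<rho>: "0 < \<rho>" "\<rho> < 1" using x nu_pos[of 1 0] by (auto simp: \<rho>_def max_def)
  have ratio: "0 \<le> sinh (nu 1 n * t) / sinh (nu 1 n * a) \<and> sinh (nu 1 n * t) / sinh (nu 1 n * a) \<le> exp (- (nu 1 0 * (a - t)))"
    if "0 < t" "t < a" for a t n
  proof -
    have "nu 1 0 * (a - t) \<le> nu 1 n * (a - t)" using nu_mono[of 1 n] that by (intro mult_right_mono) auto
    then have "exp (- (nu 1 n * (a - t))) \<le> exp (- (nu 1 0 * (a - t)))" by simp
    then show ?thesis
      using sinh_ratio_bounds[of "nu 1 n" t a] nu_pos[of 1 n] that by (auto intro: order.trans)
  qed
  have rs: "0 \<le> r n" "r n \<le> \<rho>" "0 \<le> s n" "s n \<le> \<rho>" for n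
    using ratio[of xm x0 n] ratio[of "1 - xp" "1 - x0" n] x unfolding r_def s_def \<rho>_def
    by (auto simp: le_max_iff_disj)
  have \<mu>: "0 \<le> \<mu> n" "\<mu> n \<le> \<rho>" for n
  proof -
    show "0 \<le> \<mu> n" using rs \<gamma> by (simp add: \<mu>_def)
    have "\<mu> n \<le> gm * \<rho> + gp * \<rho>" unfolding \<mu>_def using rs \<gamma> by (intro add_mono mult_left_mono) auto
    also have "\<dots> = (gm + gp) * \<rho>" by (simp add: algebra_simps)
    also have "\<dots> \<le> 1 * \<rho>" using \<gamma> \<rho> by (intro mult_right_mono) auto
    finally show "\<mu> n \<le> \<rho>" by simp
  qed
  obtain C where C: "\<And>n. \<bar>sine_coeff 1 h n\<bar> \<le> C" using bounded_sine_coeff[OF _ h(1)] by auto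
  define c where "c n = sine_coeff 1 h n / (1 - \<mu> n)" for n
  have cb: "\<bar>c n\<bar> \<le> C / (1 - \<rho>)" for n
    using C[of n] order.trans[OF abs_ge_zero C[of n]] \<mu>[of n] \<rho> unfolding c_def abs_divide
    by (intro frac_le) auto
  have sr: "summable (\<lambda>n. \<bar>c n * r n\<bar>)"
    unfolding r_def by (rule summable_side_series[OF _ _ cb]) (use x in auto)
  have ss: "summable (\<lambda>n. \<bar>c n * s n\<bar>)"
    unfolding s_def by (rule summable_side_series[OF _ _ cb]) (use x in auto)
  have s\<mu>: "summable (\<lambda>n. \<bar>c n * \<mu> n\<bar>)"
  proof (rule summable_comparison_test'[OF summable_add[OF summable_mult[OF sr, of gm] summable_mult[OF ss, of gp]]])
    fix n
    show "norm \<bar>c n * \<mu> n\<bar> \<le> gm * \<bar>c n * r n\<bar> + gp * \<bar>c n * s n\<bar>"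
      using abs_triangle_ineq[of "gm * (c n * r n)" "gp * (c n * s n)"] \<gamma>
      by (simp add: \<mu>_def distrib_left abs_mult mult.left_commute)
  qed
  define g where "g y = h y + sine_sum 1 (\<lambda>n. c n * \<mu> n) y" for y
  have gc: "continuous_on {0..1} g" unfolding g_def by (intro continuous_intros h continuous_on_sine_sum s\<mu>)
  have ge: "g 0 = 0" "g 1 = 0" by (simp_all add: g_def h)
  \<comment> \<open>\<open>g\<close> is built as a function, so its coefficients have to be
    recovered; they equal c (1 - \<mu>) + c \<mu>.\<close>
  have cg: "sine_coeff 1 g = c"
  proof
    fix n
    have "sine_coeff 1 h n = sine_coeff 1 g n - sine_coeff 1 (sine_sum 1 (\<lambda>n. c n * \<mu> n)) n"
      by (subst sine_coeff_diff[symmetric, OF gc continuous_on_sine_sum[OF s\<mu>]]) (simp add: g_def)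
    then have "sine_coeff 1 g n = sine_coeff 1 h n + c n * \<mu> n" by (simp add: sine_coeff_sine_sum[OF _ s\<mu>])
    also have "sine_coeff 1 h n = c n * (1 - \<mu> n)" using \<mu>(2)[of n] \<rho> by (simp add: c_def)
    finally show "sine_coeff 1 g n = c n" by (simp add: algebra_simps)
  qed
  have em: "side_ext x0 1 g (xm, y) = (\<Sum>n. c n * r n * sin (nu 1 n * y))" for y
    using x by (simp add: side_ext_def cg side_series_def r_def)
  have ep: "side_ext (1 - x0) 1 g (1 - xp, y) = (\<Sum>n. c n * s n * sin (nu 1 n * y))" for y
    using x by (simp add: side_ext_def cg side_series_def s_def)
  have "gm * side_ext x0 1 g (xm, y) + gp * side_ext (1 - x0) 1 g (1 - xp, y) = sine_sum 1 (\<lambda>n. c n * \<mu> n) y" for y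
  proof -
    note S = summable_sine_terms[OF sr, of 1 y] summable_sine_terms[OF ss, of 1 y]
    have "gm * side_ext x0 1 g (xm, y) + gp * side_ext (1 - x0) 1 g (1 - xp, y) =
       (\<Sum>n. gm * (c n * r n * sin (nu 1 n * y)) + gp * (c n * s n * sin (nu 1 n * y)))"
      unfolding em ep suminf_mult[OF S(1), symmetric] suminf_mult[OF S(2), symmetric]
      by (rule suminf_add) (intro summable_mult S)+
    also have "\<dots> = sine_sum 1 (\<lambda>n. c n * \<mu> n) y"
      unfolding sine_sum_def by (simp add: \<mu>_def algebra_simps)
    finally show ?thesis .
  qed
  then have "g y = gm * side_ext x0 1 g (xm, y) + gp * side_ext (1 - x0) 1 g (1 - xp, y) + h y" for y
    by (simp add: g_def[of y])
  then show ?thesis by (rule that[OF gc ge])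
qed

section \<open>Uniqueness and existence of the regular solution\<close>

lemma frontier_unit_square:
  "frontier unit_square = {(x, y). x \<in> {0..1} \<and> y \<in> {0..1} \<and> (x = 0 \<or> x = 1 \<or> y = 0 \<or> y = 1)}"
  by (auto simp: frontier_def unit_square_def closure_Times interior_Times interior_atLeastAtMost_real)

lemma open_R_minus_R_plus [simp]: "open (R_minus x0)" "open (R_plus x0)"
  by (auto simp: R_minus_def R_plus_def intro!: open_Times)

lemma regular_solution_unique:
  assumes x: "0 < xm" "xm < x0" "x0 < xp" "xp < 1"
    and \<gamma>: "gm > 0" "gp > 0" "gm + gp \<le> 1"
    and u: "regular_solution xm x0 xp gm gp fm fp \<phi>0 u"
    and v: "regular_solution xm x0 xp gm gp fm fp \<phi>0 v"
    and z: "z \<in> unit_square"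
  shows "u z = v z"
proof -
  define w where "w z = u z - v z" for z
  note U = u[unfolded regular_solution_def] and V = v[unfolded regular_solution_def]
  have wc: "continuous_on ({0..1} \<times> {0..1}) w"
    unfolding w_def[abs_def] using U V by (auto simp: unit_square_def intro!: continuous_intros)
  have "C2_laplacian (R_minus x0) w (\<lambda>z. laplacian u z - laplacian v z)"
    unfolding w_def[abs_def] using U V by (intro C2_laplacian_diff Ck_open_imp_C2_laplacian) auto
  then have wm: "C2_laplacian ({0<..<x0} \<times> {0<..<1}) w (\<lambda>_. 0)"
    unfolding R_minus_def[symmetric] by (rule C2_laplacian_cong[OF open_R_minus_R_plus(1)]) (use U V in auto)
  have "C2_laplacian (R_plus x0) w (\<lambda>z. laplacian u z - laplacian v z)"
    unfolding w_def[abs_def] using U V by (intro C2_laplacian_diff Ck_open_imp_C2_laplacian) auto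
  then have wp: "C2_laplacian ({x0<..<1} \<times> {0<..<1}) w (\<lambda>_. 0)"
    unfolding R_plus_def[symmetric] by (rule C2_laplacian_cong[OF open_R_minus_R_plus(2)]) (use U V in auto)
  have w0: "w (x, y) = 0" if "x \<in> {0..1}" "y \<in> {0..1}" "x = 0 \<or> x = 1 \<or> y = 0 \<or> y = 1" for x y
    using U V that by (auto simp: w_def frontier_unit_square)
  have wn: "w (x0, y) = gm * w (xm, y) + gp * w (xp, y)" if "y \<in> {0<..<1}" for y
    using U V that by (simp add: w_def algebra_simps)
  have "continuous_on {0..1} (\<lambda>y. \<bar>w (x0, y)\<bar>)"
    by (intro continuous_intros continuous_on_compose2[OF wc]) (use x in auto)
  then obtain y0 where y0: "y0 \<in> {0..1}" "\<And>y. y \<in> {0..1} \<Longrightarrow> \<bar>w (x0, y)\<bar> \<le> \<bar>w (x0, y0)\<bar>"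
    using continuous_attains_sup[of "{0..1::real}" "\<lambda>y. \<bar>w (x0, y)\<bar>"] by auto
  define M where "M = \<bar>w (x0, y0)\<bar>"
  have left: "\<bar>w (x, y)\<bar> \<le> 0 + M / x0 * x" if "x \<in> {0..x0}" "y \<in> {0..1}" for x y
    by (rule max_principle_affine[where p = 0 and q = x0, OF _ _ wm _ _ _ _ _ that])
      (use x y0 w0 in \<open>auto simp: M_def intro: continuous_on_subset[OF wc]\<close>)
  have right: "\<bar>w (x, y)\<bar> \<le> M / (1 - x0) + (- M / (1 - x0)) * x" if "x \<in> {x0..1}" "y \<in> {0..1}" for x y
  proof (rule max_principle_affine[where p = x0 and q = 1, OF _ _ wp _ _ _ _ _ that])
    \<comment> \<open>The affine bound in a shape that shows its sign, its value \<open>M\<close> at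
      \<open>x0\<close> and its zero at 1.\<close>
    have eq: "M / (1 - x0) + - M / (1 - x0) * t = M * ((1 - t) / (1 - x0))" for t
      by (simp add: diff_divide_distrib right_diff_distrib)
    show "0 \<le> M / (1 - x0) + - M / (1 - x0) * t" if "t \<in> {x0..1}" for t
      unfolding eq using that x by (simp add: M_def)
    show "\<bar>w (x0, y)\<bar> \<le> M / (1 - x0) + - M / (1 - x0) * x0" if "y \<in> {0..1}" for y
      unfolding eq using that x y0 by (simp add: M_def)
  qed (use x w0 in \<open>auto intro: continuous_on_subset[OF wc]\<close>)
  have M0: "M = 0"
  proof (rule ccontr)
    assume "M \<noteq> 0"
    then have Mp: "M > 0" by (simp add: M_def)
    \<comment> \<open>The contact condition holds for interior y only; at the two ends
      \<open>w\<close> vanishes, which a positive maximum excludes.\<close>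
    have y0': "y0 \<in> {0<..<1}"
      using w0[of x0 y0] x y0(1) Mp by (cases "y0 = 0 \<or> y0 = 1") (auto simp: M_def)
    have "\<bar>w (xm, y0)\<bar> \<le> 0 + M / x0 * xm" by (rule left) (use x y0 in auto)
    also have "\<dots> < M" using x Mp by (simp add: divide_less_eq)
    finally have 1: "\<bar>w (xm, y0)\<bar> < M" .
    have "\<bar>w (xp, y0)\<bar> \<le> M / (1 - x0) + - M / (1 - x0) * xp" by (rule right) (use x y0 in auto)
    also have "\<dots> = M * ((1 - xp) / (1 - x0))" by (simp add: diff_divide_distrib right_diff_distrib)
    also have "\<dots> < M * 1" using x Mp by (intro mult_strict_left_mono) auto
    finally have 2: "\<bar>w (xp, y0)\<bar> < M" by simp
    have "M = \<bar>gm * w (xm, y0) + gp * w (xp, y0)\<bar>" using wn[OF y0'] by (simp add: M_def)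
    also have "\<dots> \<le> gm * \<bar>w (xm, y0)\<bar> + gp * \<bar>w (xp, y0)\<bar>"
      using \<gamma> abs_triangle_ineq[of "gm * w (xm, y0)" "gp * w (xp, y0)"] by (simp add: abs_mult)
    also have "\<dots> < gm * M + gp * M" using 1 2 \<gamma> by (intro add_strict_mono mult_strict_left_mono) auto
    also have "\<dots> = (gm + gp) * M" by (simp add: algebra_simps)
    also have "\<dots> \<le> 1 * M" using \<gamma> Mp by (intro mult_right_mono) auto
    finally show False by simp
  qed
  obtain a b where ab: "z = (a, b)" "a \<in> {0..1}" "b \<in> {0..1}" using z by (auto simp: unit_square_def)
  \<comment> \<open>With \<open>M\<close> equal to 0 the two affine bounds are zero on their whole
    rectangles.\<close>
  have "w z = 0"
    using left[of a b] right[of a b] ab M0 by (cases "a \<le> x0") auto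
  then show ?thesis by (simp add: w_def)
qed

text \<open>\<open>P\<close> and \<open>Q\<close> vanish on the contact line, so the trace there is
  carried by the harmonic extensions of one common \<open>g\<close> to both sides. Hence the two
  pieces match, and the contact condition becomes the equation for \<open>g\<close> whose given term
  \<open>h\<close> collects \<open>\<phi>0\<close> and the values of \<open>P\<close> and
  \<open>Q\<close> at \<open>xm\<close> and \<open>xp\<close>.\<close>

lemma regular_solution_exists:
  assumes x: "0 < xm" "xm < x0" "x0 < xp" "xp < 1"
    and \<gamma>: "gm > 0" "gp > 0" "gm + gp \<le> 1"
    and fm: "Ck_closure 2 (R_minus x0) fm" and fp: "Ck_closure 2 (R_plus x0) fp"
    and \<phi>: "continuous_on {0..1} \<phi>0" "\<phi>0 0 = 0" "\<phi>0 1 = 0"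
  obtains u where "u \<in> extensional unit_square" "regular_solution xm x0 xp gm gp fm fp \<phi>0 u"
proof -
  obtain P where P: "continuous_on ({0..x0} \<times> {0..1}) P" "C2_laplacian (R_minus x0) P fm"
    "\<And>y. y \<in> {0..1} \<Longrightarrow> P (0, y) = 0" "\<And>y. y \<in> {0..1} \<Longrightarrow> P (x0, y) = 0"
    "\<And>x. x \<in> {0..x0} \<Longrightarrow> P (x, 0) = 0" "\<And>x. x \<in> {0..x0} \<Longrightarrow> P (x, 1) = 0"
    using poisson_zero_boundary[OF fm[unfolded R_minus_def]] x unfolding R_minus_def by auto
  obtain Q where Q: "continuous_on ({x0..1} \<times> {0..1}) Q" "C2_laplacian (R_plus x0) Q fp"
    "\<And>y. y \<in> {0..1} \<Longrightarrow> Q (x0, y) = 0" "\<And>y. y \<in> {0..1} \<Longrightarrow> Q (1, y) = 0"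
    "\<And>x. x \<in> {x0..1} \<Longrightarrow> Q (x, 0) = 0" "\<And>x. x \<in> {x0..1} \<Longrightarrow> Q (x, 1) = 0"
    using poisson_zero_boundary[OF fp[unfolded R_plus_def]] x unfolding R_plus_def by auto
  define h where "h y = gm * P (xm, y) + gp * Q (xp, y) + \<phi>0 y" for y
  have hc: "continuous_on {0..1} h"
    unfolding h_def[abs_def]
    by (intro continuous_intros \<phi> continuous_on_compose2[OF P(1)] continuous_on_compose2[OF Q(1)]) (use x in auto)
  have he: "h 0 = 0" "h 1 = 0" using P(5,6)[of xm] Q(5,6)[of xp] x \<phi> by (auto simp: h_def)
  obtain g where g: "continuous_on {0..1} g" "g 0 = 0" "g 1 = 0"
    "\<And>y. g y = gm * side_ext x0 1 g (xm, y) + gp * side_ext (1 - x0) 1 g (1 - xp, y) + h y"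
    using nonlocal_trace[OF x \<gamma> hc he] by metis
  have pos: "x0 > 0" "1 - x0 > 0" "(1::real) > 0" using x by auto
  note Sm = side_ext_harmonic[OF pos(1,3) g(1-3)] and Sp = side_ext_harmonic[OF pos(2,3) g(1-3)]
  note bm = side_ext_boundary[OF pos(1,3) g(2,3)] and bp = side_ext_boundary[OF pos(2,3) g(2,3)]
  define L where "L z = P z + side_ext x0 1 g z" for z
  \<comment> \<open>The reflection x to 1 - x sends the contact line to the side 1 - x0 of the
    standard rectangle and the outer side to 0.\<close>
  define R where "R z = Q z + (\<lambda>(x, y). side_ext (1 - x0) 1 g (-1 * x + 1, 1 * y + 0)) z" for z
  have Lc: "continuous_on ({0..x0} \<times> {0..1}) L"
    unfolding L_def[abs_def] by (intro continuous_intros P Sm)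
  have Rc: "continuous_on ({x0..1} \<times> {0..1}) R"
    unfolding R_def[abs_def]
    by (intro continuous_on_add Q(1) continuous_on_affine_pair[OF Sp(1)]) auto
  have LC: "C2_laplacian (R_minus x0) L fm"
    using C2_laplacian_add[OF P(2) Sm(2)[folded R_minus_def]] by (simp add: L_def[abs_def])
  have "C2_laplacian (R_plus x0) (\<lambda>(x, y). side_ext (1 - x0) 1 g (-1 * x + 1, 1 * y + 0))
    (\<lambda>(x, y). (\<lambda>_. 0) (-1 * x + 1, 1 * y + 0 :: real))"
    by (rule C2_laplacian_affine[OF Sp(2)]) (auto simp: R_plus_def)
  from C2_laplacian_add[OF Q(2) this] have RC: "C2_laplacian (R_plus x0) R fp"
    by (simp add: R_def[abs_def] case_prod_unfold)
  have Lv: "L (0, y) = 0" "L (x0, y) = g y" if "y \<in> {0..1}" for y using P(3,4) bm that by (auto simp: L_def)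
  have Lh: "L (x, 0) = 0" "L (x, 1) = 0" if "x \<in> {0..x0}" for x using P(5,6) bm that by (auto simp: L_def)
  have Rv: "R (1, y) = 0" "R (x0, y) = g y" if "y \<in> {0..1}" for y using Q(3,4) bp that by (auto simp: R_def)
  have Rh: "R (x, 0) = 0" "R (x, 1) = 0" if "x \<in> {x0..1}" for x using Q(5,6) bp that by (auto simp: R_def)
  \<comment> \<open>Assigning the contact line to \<open>L\<close> is harmless, as \<open>R\<close>
    has the same value \<open>g\<close> there. The value \<open>undefined\<close> off the square
    makes \<open>u\<close> extensional.\<close>
  define u where "u z = (if z \<in> unit_square then if fst z \<le> x0 then L z else R z else undefined)" for z
  have uL: "u (x, y) = L (x, y)" if "x \<in> {0..x0}" "y \<in> {0..1}" for x y
    using that x by (auto simp: u_def unit_square_def)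
  have uR: "u (x, y) = R (x, y)" if "x \<in> {x0..1}" "y \<in> {0..1}" for x y
    using that x Lv(2) Rv(2) by (cases "x = x0") (auto simp: u_def unit_square_def)
  have sq: "unit_square = {0..x0} \<times> {0..1} \<union> {x0..1} \<times> {0..1}"
    using x by (auto simp: unit_square_def)
  have uc: "continuous_on unit_square u"
    unfolding sq
  proof (rule continuous_on_closed_Un)
    show "continuous_on ({0..x0} \<times> {0..1}) u" using Lc by (rule continuous_on_eq) (auto simp: uL)
    show "continuous_on ({x0..1} \<times> {0..1}) u" using Rc by (rule continuous_on_eq) (auto simp: uR)
  qed (auto intro!: closed_Times)
  have uLC: "C2_laplacian (R_minus x0) u fm"
    by (rule C2_laplacian_cong[OF open_R_minus_R_plus(1) LC]) (auto simp: R_minus_def uL)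
  have uRC: "C2_laplacian (R_plus x0) u fp"
    by (rule C2_laplacian_cong[OF open_R_minus_R_plus(2) RC]) (auto simp: R_plus_def uR)
  have "regular_solution xm x0 xp gm gp fm fp \<phi>0 u"
    unfolding regular_solution_def
  proof (intro conjI ballI)
    show "u z = 0" if "z \<in> frontier unit_square" for z
    proof -
      obtain a b where z: "z = (a, b)" by force
      then have ab: "z = (a, b)" "a \<in> {0..1}" "b \<in> {0..1}" "a = 0 \<or> a = 1 \<or> b = 0 \<or> b = 1"
        using that by (auto simp: frontier_unit_square)
      show ?thesis
      proof (cases "a \<le> x0")
        case True
        then show ?thesis using ab uL[of a b] Lv(1)[of b] Lh[of a] x by auto
      next
        case False
        then show ?thesis using ab uR[of a b] Rv(1)[of b] Rh[of a] x by auto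
      qed
    qed
    fix y :: real assume "y \<in> {0<..<1}"
    then have y: "y \<in> {0..1}" by auto
    have "u (x0, y) = g y" "u (xm, y) = P (xm, y) + side_ext x0 1 g (xm, y)"
      "u (xp, y) = Q (xp, y) + side_ext (1 - x0) 1 g (1 - xp, y)"
      using y x uL[of x0 y] uL[of xm y] uR[of xp y] Lv(2)[of y] by (auto simp: L_def R_def)
    then show "u (x0, y) = gm * u (xm, y) + gp * u (xp, y) + \<phi>0 y"
      using g(4)[of y] by (simp add: h_def algebra_simps)
  qed (use uc C2_laplacian_imp_Ck_open[OF open_R_minus_R_plus(1) uLC] C2_laplacian_imp_Ck_open[OF open_R_minus_R_plus(2) uRC] in auto)
  moreover have "u \<in> extensional unit_square" by (simp add: extensional_def u_def)
  ultimately show ?thesis using that by blast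
qed

theorem theorem1:
  fixes xm x0 xp gm gp :: real
  assumes "0 < xm" "xm < x0" "x0 < xp" "xp < 1"
    and "gm > 0" "gp > 0" "gm + gp \<le> 1"
  shows "\<exists>m::nat. \<forall>fm fp \<phi>0.
    Ck_closure m (R_minus x0) fm \<longrightarrow> Ck_closure m (R_plus x0) fp \<longrightarrow>
    Ck_interval m 0 1 \<phi>0 \<longrightarrow> \<phi>0 0 = 0 \<longrightarrow> \<phi>0 1 = 0 \<longrightarrow>
    (\<exists>!u. u \<in> extensional unit_square \<and> regular_solution xm x0 xp gm gp fm fp \<phi>0 u)"
proof (intro exI[of _ 2] allI impI)
  \<comment> \<open>The order 2 is what two integrations by parts in x2 ask of the right-hand
    sides.\<close>
  fix fm fp \<phi>0
  assume f: "Ck_closure 2 (R_minus x0) fm" "Ck_closure 2 (R_plus x0) fp"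
    and "Ck_interval 2 0 1 \<phi>0" "\<phi>0 0 = 0" "\<phi>0 1 = 0"
  then have \<phi>: "continuous_on {0..1} \<phi>0" "\<phi>0 0 = 0" "\<phi>0 1 = 0" by (simp_all add: Ck_interval_def)
  obtain u where u: "u \<in> extensional unit_square" "regular_solution xm x0 xp gm gp fm fp \<phi>0 u"
    using regular_solution_exists[OF assms f \<phi>] by blast
  show "\<exists>!u. u \<in> extensional unit_square \<and> regular_solution xm x0 xp gm gp fm fp \<phi>0 u"
  proof (rule ex1I[of _ u])
    \<comment> \<open>The conditions determine a solution on the square; among extensional
      functions, agreement there is equality.\<close>
    fix v assume v: "v \<in> extensional unit_square \<and> regular_solution xm x0 xp gm gp fm fp \<phi>0 v"
    show "v = u"
      by (rule extensionalityI[of _ unit_square])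
        (use v u regular_solution_unique[OF assms, of fm fp \<phi>0 v u] in auto)
  qed (use u in simp)
qed

end
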